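(* Let $d\ge 2$. For the algebra $H^\infty(\mathcal B^d)$ of bounded nc functions in the row ball, the constants $C_n$ satisfy $C_n=\sqrt n$ for all $n=1,2,\dots$. Here $C_n$ is the least constant such that $\big\|\sum_{i=1}^n A_iA_i^*\big\|^{1/2}\le C_n\big\|\sum_{i=1}^n A_i^*A_i\big\|^{1/2}$ for all $n$-tuples $A_1,\dots,A_n$ of elements of $H^\infty(\mathcal B^d)$, viewed as operators as described in the context.
   Context: Row ball: $\mathcal B^d=\bigsqcup_{m\ge1}\mathcal B^d_m$, where $\mathcal B^d_m$ is the set of $d$-tuples $X=(X_1,\dots,X_d)$ of complex $m\times m$ matrices with $\|X_1X_1^*+\cdots+X_dX_d^*\|<1$. An nc function $f:\mathcal B^d\to\bigsqcup_m M_m(\mathbb C)$ is a graded function (it maps $\mathcal B^d_m$ into $M_m(\mathbb C)$) with $f(X\oplus Y)=f(X)\oplus f(Y)$ (direct sums of tuples are coordinatewise) and $f(S^{-1}XS)=S^{-1}f(X)S$ whenever $S$ is invertible and both $X$ and $S^{-1}XS=(S^{-1}X_1S,\dots,S^{-1}X_dS)$ lie in $\mathcal B^d$. $H^\infty(\mathcal B^d)$ is the algebra of nc functions with $\|f\|_\infty=\sup_{X\in\mathcal B^d}\|f(X)\|<\infty$. Operator realization: let $\mathcal F^2_d$ be the Hilbert space with orthonormal basis $\{\xi_w\}$ indexed by all words $w$ (including the empty word) in the letters $1,\dots,d$, let $L_i\xi_w=\xi_{iw}$, and let $\mathcal L_d$ (the free semigroup algebra) be the WOT-closed algebra generated by $L_1,\dots,L_d$.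 By a theorem of Popescu, $H^\infty(\mathcal B^d)$ is completely isometrically identified with $\mathcal L_d\subset B(\mathcal F^2_d)$ (the coordinate function $x_i$ corresponding to $L_i$). Under this identification, for $f_1,\dots,f_n\in H^\infty(\mathcal B^d)$, $\|\sum f_if_i^*\|^{1/2}$ is the $H^\infty$ norm of the row $[f_1\ \cdots\ f_n]$, i.e. $\sup_{X\in\mathcal B^d}\|\sum f_i(X)f_i(X)^*\|^{1/2}$, and $\|\sum f_i^*f_i\|^{1/2}$ is the $H^\infty$ norm of the corresponding column, i.e. $\sup_{X\in\mathcal B^d}\|\sum f_i(X)^*f_i(X)\|^{1/2}$. *)

theory Defs
  imports "Jordan_Normal_Form.Schur_Decomposition" "HOL-Analysis.L2_Norm"
begin

definition vec_l2_norm :: "complex vec \<Rightarrow> real" where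
  "vec_l2_norm v = L2_set (\<lambda>i. cmod (v $ i)) {..<dim_vec v}"

(* The operator norm of a matrix between Euclidean spaces. The set is nonempty and
   bounded, so the real supremum is the genuine one. *)
definition mat_op_norm :: "complex mat \<Rightarrow> real" where
  "mat_op_norm A =
     (SUP v \<in> {v \<in> carrier_vec (dim_col A). vec_l2_norm v \<le> 1}. vec_l2_norm (A *\<^sub>v v))"

(* The sum of the m x m matrices A i (i < k). The type of matrices of all sizes is not a
   commutative monoid, so the sum is written entrywise. *)
definition mat_sum :: "nat \<Rightarrow> nat \<Rightarrow> (nat \<Rightarrow> complex mat) \<Rightarrow> complex mat" where
  "mat_sum m k A = mat m m (\<lambda>(p, q). \<Sum>i<k. A i $$ (p, q))"

type_synonym mat_tuple = "complex mat list"

definition row_ball_level :: "nat \<Rightarrow> nat \<Rightarrow> mat_tuple set" where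
  "row_ball_level d m =
     {X. length X = d \<and> set X \<subseteq> carrier_mat m m \<and>
         mat_op_norm (mat_sum m d (\<lambda>i. X ! i * mat_adjoint (X ! i))) < 1}"

definition row_ball :: "nat \<Rightarrow> mat_tuple set" where
  "row_ball d = (\<Union>m\<in>{1..}. row_ball_level d m)"

definition mat_dsum :: "complex mat \<Rightarrow> complex mat \<Rightarrow> complex mat" where
  "mat_dsum A B = diag_block_mat [A, B]"

definition tuple_dsum :: "mat_tuple \<Rightarrow> mat_tuple \<Rightarrow> mat_tuple" where
  "tuple_dsum X Y = map2 mat_dsum X Y"

(* In the similarity clause T is the inverse of S. Only the values of f on the row ball
   are constrained; functions that agree there represent the same nc function. *)
definition nc_function :: "nat \<Rightarrow> (mat_tuple \<Rightarrow> complex mat) \<Rightarrow> bool" where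
  "nc_function d f \<longleftrightarrow>
     (\<forall>m\<ge>1. \<forall>X\<in>row_ball_level d m. f X \<in> carrier_mat m m) \<and>
     (\<forall>X\<in>row_ball d. \<forall>Y\<in>row_ball d. f (tuple_dsum X Y) = mat_dsum (f X) (f Y)) \<and>
     (\<forall>m\<ge>1. \<forall>X\<in>row_ball_level d m. \<forall>S\<in>carrier_mat m m. \<forall>T\<in>carrier_mat m m.
        inverts_mat S T \<longrightarrow> inverts_mat T S \<longrightarrow>
        map (\<lambda>A. T * A * S) X \<in> row_ball d \<longrightarrow>
        f (map (\<lambda>A. T * A * S) X) = T * f X * S)"

definition H_infty :: "nat \<Rightarrow> (mat_tuple \<Rightarrow> complex mat) set" where
  "H_infty d = {f. nc_function d f \<and> bdd_above ((\<lambda>X. mat_op_norm (f X)) ` row_ball d)}"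

(* The norms of the row and of the column with entries f 0, ..., f (n - 1), i.e. the operator
   quantities || sum f_i f_i^* ||^(1/2) and || sum f_i^* f_i ||^(1/2), which Popescu's completely
   isometric identification of H_infty d with the free semigroup algebra turns into suprema
   over the row ball. For f i in H_infty d the suprema are over nonempty bounded sets. *)
definition row_norm :: "nat \<Rightarrow> nat \<Rightarrow> (nat \<Rightarrow> mat_tuple \<Rightarrow> complex mat) \<Rightarrow> real" where
  "row_norm d n f =
     Sup {sqrt (mat_op_norm (mat_sum m n (\<lambda>i. f i X * mat_adjoint (f i X)))) | m X.
            1 \<le> m \<and> X \<in> row_ball_level d m}"

definition column_norm :: "nat \<Rightarrow> nat \<Rightarrow> (nat \<Rightarrow> mat_tuple \<Rightarrow> complex mat) \<Rightarrow> real" where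
  "column_norm d n f =
     Sup {sqrt (mat_op_norm (mat_sum m n (\<lambda>i. mat_adjoint (f i X) * f i X))) | m X.
            1 \<le> m \<and> X \<in> row_ball_level d m}"

definition column_row_bound :: "nat \<Rightarrow> nat \<Rightarrow> real \<Rightarrow> bool" where
  "column_row_bound d n C \<longleftrightarrow>
     (\<forall>f. (\<forall>i<n. f i \<in> H_infty d) \<longrightarrow> row_norm d n f \<le> C * column_norm d n f)"

(* "C is the least constant", including that the least constant exists. *)
definition is_column_row_constant :: "nat \<Rightarrow> nat \<Rightarrow> real \<Rightarrow> bool" where
  "is_column_row_constant d n C \<longleftrightarrow>
     column_row_bound d n C \<and> (\<forall>C'. column_row_bound d n C' \<longrightarrow> C \<le> C')"

end

(* Pointwise each f_i has norm at most that of the column, so the row norm is at most sqrt n times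
   the column norm.

   For the converse take words y_zi (z, i < n) in x_0, x_1 that form a prefix code, and put
   Q = (y_zi / sqrt n). If y_zi takes the value E_zi / sqrt n, then Q = (1/n) sum E_zi (x) E_zi is the
   projection onto the maximally entangled vector, so n Q^k has (z, j) entry E_zj for all k, and so
   have its Abel means n eta sum_k (1 - eta)^(k-1) Q^k. The first row of such a mean is an n-tuple of
   nc functions taking the values E_00, ..., E_0(n-1), whose row norm is sqrt n. Averaging over the
   degrees k makes the column norm tend to 1 as eta tends to 0: one step of the recursion
   turns a squared energy T of the state into at most
   ((1 - eta) sqrt T + eta)^2 + (n^2 - 1) eta^2, because y is a row contraction. *)
theory Submission
  imports Defs
begin

section \<open>Operator norms and Gram matrices\<close>

text \<open>A single power of Q will not do: the first row of n Q^k, read as a column, has norm n in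
  the Fock model, since distinct products of code words have orthogonal ranges. Averaging separates
  noise from drift. Fresh input enters each step with a coefficient of order eta; its incoherent
  part adds at most about n^2 eta^2 to the energy, and damping at rate eta lets only about 1/eta
  steps count, so the noise stays of order n^2 eta, while the coherent part merely pulls the square
  root of the energy towards 1. At the special point the average costs nothing, because Q is
  idempotent there. The factor 1/sqrt n is the largest t for which the t E_zi form a row
  contraction, as the sum of all E_zi E_zi^* is n times the identity; the same factor makes Q a
  projection. The point producing these values lies on the boundary of the open ball, so it is
  scaled by r < 1. Truncating the Abel means keeps the test functions polynomial: they are nc
  functions by closure rules, and their values at the scaled point are continuous in r. Words
  instead of letters supply the n^2 generators from two variables, so d = 2 suffices.\<close>

lemma vec_l2_norm_nonneg [simp]: "0 \<le> vec_l2_norm v"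
  by (simp add: vec_l2_norm_def L2_set_nonneg)

lemma vec_l2_norm_sq: "(vec_l2_norm v)\<^sup>2 = (\<Sum>i<dim_vec v. (cmod (v $ i))\<^sup>2)"
  by (simp add: vec_l2_norm_def L2_set_def sum_nonneg)

lemma cscalar_prod_self: "v \<bullet>c v = complex_of_real ((vec_l2_norm v)\<^sup>2)"
  by (simp add: vec_l2_norm_sq scalar_prod_def atLeast0LessThan complex_norm_square
      del: of_real_power)

lemma norm_cscalar_prod_self: "cmod (v \<bullet>c v) = (vec_l2_norm v)\<^sup>2"
  unfolding cscalar_prod_self by (simp only: norm_of_real abs_power2)

lemma cscalar_prod_le:
  assumes "dim_vec v = dim_vec w"
  shows "cmod (v \<bullet>c w) \<le> vec_l2_norm v * vec_l2_norm w"
proof -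
  have "cmod (v \<bullet>c w) \<le> (\<Sum>i<dim_vec w. cmod (v $ i) * cmod (w $ i))"
    by (auto simp: scalar_prod_def atLeast0LessThan norm_mult intro!: sum_norm_le)
  also have "\<dots> \<le> vec_l2_norm v * vec_l2_norm w"
    using L2_set_mult_ineq[of "\<lambda>i. cmod (v $ i)" "\<lambda>i. cmod (w $ i)" "{..<dim_vec w}"] assms
    by (simp add: vec_l2_norm_def)
  finally show ?thesis .
qed

lemma vec_l2_norm_smult: "vec_l2_norm (c \<cdot>\<^sub>v v) = cmod c * vec_l2_norm v"
  unfolding vec_l2_norm_def by (subst L2_set_right_distrib) (auto intro!: L2_set_cong simp: norm_mult)

lemma vec_l2_norm_zero [simp]: "vec_l2_norm (0\<^sub>v m) = 0"
  by (simp add: vec_l2_norm_def L2_set_def)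

text \<open>The constant is the Frobenius norm. This crude bound shows that the set in
  \<open>mat_op_norm\<close> is bounded above, without which the real supremum would carry no
  information.\<close>

lemma mult_mat_vec_bounded:
  obtains K where "0 \<le> K"
    "\<And>v. v \<in> carrier_vec (dim_col A) \<Longrightarrow> vec_l2_norm (A *\<^sub>v v) \<le> K * vec_l2_norm v"
proof -
  let ?K = "L2_set (\<lambda>i. vec_l2_norm (conjugate (row A i))) {..<dim_row A}"
  have "vec_l2_norm (A *\<^sub>v v) \<le> ?K * vec_l2_norm v" if v: "v \<in> carrier_vec (dim_col A)" for v
  proof -
    have "cmod (row A i \<bullet> v) \<le> vec_l2_norm (conjugate (row A i)) * vec_l2_norm v"
      if "i < dim_row A" for i
    proof -
      have "row A i \<bullet> v = v \<bullet>c conjugate (row A i)"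
        using v that by (simp add: scalar_prod_def mult.commute)
      then show ?thesis
        using cscalar_prod_le[of v "conjugate (row A i)"] v by (simp add: mult.commute)
    qed
    then show ?thesis
      by (auto simp: vec_l2_norm_def[of "A *\<^sub>v v"] L2_set_left_distrib intro!: L2_set_mono)
  qed
  then show thesis
    using that[of ?K] L2_set_nonneg by blast
qed

lemma mat_op_norm_bdd:
  "bdd_above ((\<lambda>v. vec_l2_norm (A *\<^sub>v v)) `
     {v \<in> carrier_vec (dim_col A). vec_l2_norm v \<le> 1})"
proof -
  obtain K where K: "0 \<le> K"
    "\<And>v. v \<in> carrier_vec (dim_col A) \<Longrightarrow> vec_l2_norm (A *\<^sub>v v) \<le> K * vec_l2_norm v"
    using mult_mat_vec_bounded[of A] by blast
  have "vec_l2_norm (A *\<^sub>v v) \<le> K" if "v \<in> carrier_vec (dim_col A)" "vec_l2_norm v \<le> 1" for v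
    using K(2)[OF that(1)] mult_left_mono[OF that(2) K(1)] by simp
  then show ?thesis
    by (intro bdd_aboveI[of _ K]) auto
qed

lemma mat_op_norm_leI:
  assumes "0 \<le> c"
    and "\<And>v. v \<in> carrier_vec (dim_col A) \<Longrightarrow> vec_l2_norm (A *\<^sub>v v) \<le> c * vec_l2_norm v"
  shows "mat_op_norm A \<le> c"
  unfolding mat_op_norm_def
proof (rule cSUP_least)
  have "0\<^sub>v (dim_col A) \<in> {v \<in> carrier_vec (dim_col A). vec_l2_norm v \<le> 1}"
    by simp
  then show "{v \<in> carrier_vec (dim_col A). vec_l2_norm v \<le> 1} \<noteq> {}"
    by blast
  show "vec_l2_norm (A *\<^sub>v v) \<le> c" if "v \<in> {v \<in> carrier_vec (dim_col A). vec_l2_norm v \<le> 1}" for v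
    using assms(2)[of v] mult_left_mono[of "vec_l2_norm v" 1 c] that assms(1) by auto
qed

lemma mat_op_norm_nonneg: "0 \<le> mat_op_norm A"
proof -
  have "vec_l2_norm (A *\<^sub>v 0\<^sub>v (dim_col A)) \<le> mat_op_norm A"
    unfolding mat_op_norm_def by (rule cSUP_upper[OF _ mat_op_norm_bdd]) simp
  then show ?thesis
    using vec_l2_norm_nonneg order_trans by blast
qed

lemma mat_op_norm_mult_vec:
  assumes v: "v \<in> carrier_vec (dim_col A)"
  shows "vec_l2_norm (A *\<^sub>v v) \<le> mat_op_norm A * vec_l2_norm v"
proof (cases "vec_l2_norm v = 0")
  case True
  obtain K where "vec_l2_norm (A *\<^sub>v v) \<le> K * vec_l2_norm v"
    using mult_mat_vec_bounded[of A] v by metis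
  with True show ?thesis by simp
next
  case False
  define c where "c = complex_of_real (inverse (vec_l2_norm v))"
  have c: "cmod c = inverse (vec_l2_norm v)"
    by (simp add: c_def norm_inverse)
  have "vec_l2_norm (A *\<^sub>v (c \<cdot>\<^sub>v v)) \<le> mat_op_norm A"
    unfolding mat_op_norm_def
    by (rule cSUP_upper[OF _ mat_op_norm_bdd]) (use v False in \<open>simp add: vec_l2_norm_smult c\<close>)
  also have "A *\<^sub>v (c \<cdot>\<^sub>v v) = c \<cdot>\<^sub>v (A *\<^sub>v v)"
    using v by (intro mult_mat_vec) auto
  finally have "inverse (vec_l2_norm v) * vec_l2_norm (A *\<^sub>v v) \<le> mat_op_norm A"
    by (simp add: vec_l2_norm_smult c)
  then show ?thesis
    using False vec_l2_norm_nonneg[of v] by (simp add: field_simps)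
qed

section \<open>Adjoints and the sesquilinear form of a Gram matrix\<close>

lemma mat_adjoint_dim [simp]:
  "dim_row (mat_adjoint A) = dim_col A" "dim_col (mat_adjoint A) = dim_row A"
  by (auto simp: mat_adjoint_def)

lemma mat_adjoint_index [simp]:
  "i < dim_col A \<Longrightarrow> j < dim_row A \<Longrightarrow> mat_adjoint A $$ (i, j) = cnj (A $$ (j, i))"
  by (simp add: mat_adjoint_def mat_of_rows_index)

lemma mat_adjoint_carrier [simp]:
  "A \<in> carrier_mat m k \<Longrightarrow> mat_adjoint A \<in> carrier_mat k m"
  by auto

lemma mat_adjoint_adjoint [simp]: "mat_adjoint (mat_adjoint A) = (A :: complex mat)"
  by (rule eq_matI) auto

lemma cscalar_prod_adjoint:
  fixes A :: "complex mat"
  assumes "A \<in> carrier_mat m k" "v \<in> carrier_vec k" "w \<in> carrier_vec m"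
  shows "(A *\<^sub>v v) \<bullet>c w = v \<bullet>c (mat_adjoint A *\<^sub>v w)"
proof -
  have "(A *\<^sub>v v) \<bullet>c w = (\<Sum>i<m. \<Sum>j<k. A $$ (i, j) * v $ j * cnj (w $ i))"
    using assms by (simp add: scalar_prod_def atLeast0LessThan sum_distrib_right)
  also have "\<dots> = (\<Sum>j<k. \<Sum>i<m. A $$ (i, j) * v $ j * cnj (w $ i))"
    by (rule sum.swap)
  also have "\<dots> = v \<bullet>c (mat_adjoint A *\<^sub>v w)"
    using assms by (simp add: scalar_prod_def atLeast0LessThan sum_distrib_left mult_ac)
  finally show ?thesis .
qed

lemma mat_sum_carrier [simp]: "mat_sum m k A \<in> carrier_mat m m"
  by (simp add: mat_sum_def)

lemma mat_sum_mult_vec: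
  assumes "\<And>i. i < k \<Longrightarrow> A i \<in> carrier_mat m m" "v \<in> carrier_vec m"
  shows "mat_sum m k A *\<^sub>v v = vec m (\<lambda>p. \<Sum>i<k. (A i *\<^sub>v v) $ p)"
proof (rule eq_vecI)
  fix p assume "p < dim_vec (vec m (\<lambda>p. \<Sum>i<k. (A i *\<^sub>v v) $ p))"
  then have p: "p < m" by simp
  have "(mat_sum m k A *\<^sub>v v) $ p = (\<Sum>q<m. \<Sum>i<k. A i $$ (p, q) * v $ q)"
    using p assms(2) by (simp add: mat_sum_def scalar_prod_def atLeast0LessThan sum_distrib_right)
  also have "\<dots> = (\<Sum>i<k. \<Sum>q<m. A i $$ (p, q) * v $ q)"
    by (rule sum.swap)
  also have "\<dots> = (\<Sum>i<k. (A i *\<^sub>v v) $ p)"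
    using p assms by (intro sum.cong refl) (force simp: scalar_prod_def atLeast0LessThan)
  finally show "(mat_sum m k A *\<^sub>v v) $ p = vec m (\<lambda>p. \<Sum>i<k. (A i *\<^sub>v v) $ p) $ p"
    using p by simp
qed (simp add: mat_sum_def)

lemma cscalar_prod_vec_sum:
  fixes w :: "complex vec"
  assumes "w \<in> carrier_vec m"
  shows "vec m (\<lambda>p. \<Sum>i<k. u i $ p) \<bullet>c w = (\<Sum>i<k. u i \<bullet>c w)"
proof -
  have "vec m (\<lambda>p. \<Sum>i<k. u i $ p) \<bullet>c w = (\<Sum>p<m. \<Sum>i<k. u i $ p * cnj (w $ p))"
    using assms by (simp add: scalar_prod_def atLeast0LessThan sum_distrib_right)
  also have "\<dots> = (\<Sum>i<k. \<Sum>p<m. u i $ p * cnj (w $ p))"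
    by (rule sum.swap)
  finally show ?thesis
    using assms by (simp add: scalar_prod_def atLeast0LessThan)
qed

text \<open>Two different vectors are allowed because \<open>gram_norm_upper\<close> evaluates the
  form of the Gram matrix B at the pair v, B v.\<close>

lemma gram_form:
  assumes A: "\<And>i. i < k \<Longrightarrow> A i \<in> carrier_mat m m"
    and v: "v \<in> carrier_vec m" and w: "w \<in> carrier_vec m"
  shows "(mat_sum m k (\<lambda>i. mat_adjoint (A i) * A i) *\<^sub>v v) \<bullet>c w
    = (\<Sum>i<k. (A i *\<^sub>v v) \<bullet>c (A i *\<^sub>v w))"
proof -
  have "(mat_sum m k (\<lambda>i. mat_adjoint (A i) * A i) *\<^sub>v v) \<bullet>c w
      = (\<Sum>i<k. ((mat_adjoint (A i) * A i) *\<^sub>v v) \<bullet>c w)"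
    using A v w by (subst mat_sum_mult_vec)
      (auto simp: cscalar_prod_vec_sum intro!: mult_carrier_mat[of _ m m])
  also have "\<dots> = (\<Sum>i<k. (A i *\<^sub>v v) \<bullet>c (A i *\<^sub>v w))"
  proof (intro sum.cong refl)
    fix i assume "i \<in> {..<k}"
    then have Ai: "A i \<in> carrier_mat m m" using A by simp
    have "(mat_adjoint (A i) * A i) *\<^sub>v v = mat_adjoint (A i) *\<^sub>v (A i *\<^sub>v v)"
      using Ai v by (intro assoc_mult_mat_vec) auto
    then show "((mat_adjoint (A i) * A i) *\<^sub>v v) \<bullet>c w = (A i *\<^sub>v v) \<bullet>c (A i *\<^sub>v w)"
      using cscalar_prod_adjoint[of "mat_adjoint (A i)" m m "A i *\<^sub>v v" w] Ai v w by simp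
  qed
  finally show ?thesis .
qed

text \<open>Cauchy-Schwarz for the pairing of B v with v, where B is the Gram matrix. Together with
  \<open>gram_norm_upper\<close> it trades norms of matrix sums for sums of squared vector norms,
  the form in which all later estimates are made.\<close>

lemma gram_norm_lower:
  assumes A: "\<And>i. i < k \<Longrightarrow> A i \<in> carrier_mat m m" and v: "v \<in> carrier_vec m"
  shows "(\<Sum>i<k. (vec_l2_norm (A i *\<^sub>v v))\<^sup>2)
    \<le> mat_op_norm (mat_sum m k (\<lambda>i. mat_adjoint (A i) * A i)) * (vec_l2_norm v)\<^sup>2"
proof -
  let ?B = "mat_sum m k (\<lambda>i. mat_adjoint (A i) * A i)"
  have "complex_of_real (\<Sum>i<k. (vec_l2_norm (A i *\<^sub>v v))\<^sup>2) = (?B *\<^sub>v v) \<bullet>c v"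
    using gram_form[OF A v v] by (simp add: cscalar_prod_self)
  then have "(\<Sum>i<k. (vec_l2_norm (A i *\<^sub>v v))\<^sup>2) \<le> cmod ((?B *\<^sub>v v) \<bullet>c v)"
    by (metis abs_ge_self norm_of_real)
  also have "\<dots> \<le> vec_l2_norm (?B *\<^sub>v v) * vec_l2_norm v"
    using v by (intro cscalar_prod_le) (simp add: mat_sum_def)
  also have "\<dots> \<le> (mat_op_norm ?B * vec_l2_norm v) * vec_l2_norm v"
    using v by (intro mult_right_mono mat_op_norm_mult_vec) (auto simp: mat_sum_def)
  finally show ?thesis
    by (simp add: power2_eq_square mult.assoc)
qed

text \<open>With w = B v, the form of B at (v, w) is the squared norm of w. Cauchy-Schwarz over i,
  with the hypothesis used at both v and w, bounds it by c times the norms of v and w, and one norm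
  of w cancels.\<close>

lemma gram_norm_upper:
  fixes A :: "nat \<Rightarrow> complex mat"
  assumes A: "\<And>i. i < k \<Longrightarrow> A i \<in> carrier_mat m m" and c: "0 \<le> c"
    and le: "\<And>v. v \<in> carrier_vec m \<Longrightarrow>
      (\<Sum>i<k. (vec_l2_norm (A i *\<^sub>v v))\<^sup>2) \<le> c * (vec_l2_norm v)\<^sup>2"
  shows "mat_op_norm (mat_sum m k (\<lambda>i. mat_adjoint (A i) * A i)) \<le> c"
proof (rule mat_op_norm_leI[OF c])
  let ?B = "mat_sum m k (\<lambda>i. mat_adjoint (A i) * A i)"
  fix v :: "complex vec" assume "v \<in> carrier_vec (dim_col ?B)"
  then have v: "v \<in> carrier_vec m" by (simp add: mat_sum_def)
  define w where "w = ?B *\<^sub>v v"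
  have w: "w \<in> carrier_vec m"
    using v unfolding w_def by (metis mat_sum_carrier mult_mat_vec_carrier)
  have bd: "L2_set (\<lambda>i. vec_l2_norm (A i *\<^sub>v u)) {..<k} \<le> sqrt c * vec_l2_norm u"
    if "u \<in> carrier_vec m" for u
  proof -
    have "sqrt (\<Sum>i<k. (vec_l2_norm (A i *\<^sub>v u))\<^sup>2) \<le> sqrt (c * (vec_l2_norm u)\<^sup>2)"
      by (rule real_sqrt_le_mono[OF le[OF that]])
    also have "\<dots> = sqrt c * vec_l2_norm u"
      by (subst real_sqrt_mult) simp
    finally show ?thesis
      unfolding L2_set_def .
  qed
  have "w \<bullet>c w = (\<Sum>i<k. (A i *\<^sub>v v) \<bullet>c (A i *\<^sub>v w))"
    using gram_form[of k A m v w] A v w by (simp add: w_def[symmetric])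
  then have "(vec_l2_norm w)\<^sup>2 = cmod (\<Sum>i<k. (A i *\<^sub>v v) \<bullet>c (A i *\<^sub>v w))"
    by (metis norm_cscalar_prod_self)
  also have "\<dots> \<le> (\<Sum>i<k. vec_l2_norm (A i *\<^sub>v v) * vec_l2_norm (A i *\<^sub>v w))"
    by (intro sum_norm_le cscalar_prod_le) simp
  also have "\<dots> \<le> L2_set (\<lambda>i. vec_l2_norm (A i *\<^sub>v v)) {..<k} *
      L2_set (\<lambda>i. vec_l2_norm (A i *\<^sub>v w)) {..<k}"
    using L2_set_mult_ineq[of "\<lambda>i. vec_l2_norm (A i *\<^sub>v v)" "\<lambda>i. vec_l2_norm (A i *\<^sub>v w)"] by simp
  also have "\<dots> \<le> (sqrt c * vec_l2_norm v) * (sqrt c * vec_l2_norm w)"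
    by (intro mult_mono bd v w) (auto simp: L2_set_nonneg c)
  also have "\<dots> = (c * vec_l2_norm v) * vec_l2_norm w"
    using c by simp
  finally have "vec_l2_norm w * vec_l2_norm w \<le> (c * vec_l2_norm v) * vec_l2_norm w"
    by (simp add: power2_eq_square)
  then show "vec_l2_norm (?B *\<^sub>v v) \<le> c * vec_l2_norm v"
    using c vec_l2_norm_nonneg[of w] vec_l2_norm_nonneg[of v] unfolding w_def[symmetric]
    by (cases "vec_l2_norm w = 0") (auto simp: mult_le_cancel_right)
qed

lemma adjoint_norm_le:
  assumes A: "A \<in> carrier_mat m m" and c: "0 \<le> c"
    and le: "\<And>v. v \<in> carrier_vec m \<Longrightarrow> vec_l2_norm (A *\<^sub>v v) \<le> c * vec_l2_norm v"
    and v: "v \<in> carrier_vec m"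
  shows "vec_l2_norm (mat_adjoint A *\<^sub>v v) \<le> c * vec_l2_norm v"
proof -
  define w where "w = mat_adjoint A *\<^sub>v v"
  have w: "w \<in> carrier_vec m"
    using A v unfolding w_def by (intro mult_mat_vec_carrier[of _ m m]) auto
  have "(vec_l2_norm w)\<^sup>2 = cmod ((A *\<^sub>v w) \<bullet>c v)"
    unfolding cscalar_prod_adjoint[OF A w v] w_def[symmetric] by (rule norm_cscalar_prod_self[symmetric])
  also have "\<dots> \<le> vec_l2_norm (A *\<^sub>v w) * vec_l2_norm v"
    using A v by (intro cscalar_prod_le) auto
  also have "\<dots> \<le> (c * vec_l2_norm w) * vec_l2_norm v"
    by (intro mult_right_mono le w) simp
  finally have "vec_l2_norm w * vec_l2_norm w \<le> (c * vec_l2_norm v) * vec_l2_norm w"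
    by (simp add: power2_eq_square mult_ac)
  then show ?thesis
    using c vec_l2_norm_nonneg[of w] vec_l2_norm_nonneg[of v] unfolding w_def[symmetric]
    by (cases "vec_l2_norm w = 0") (auto simp: mult_le_cancel_right)
qed

section \<open>The row ball and the upper bound\<close>

lemma row_ball_level_carrier:
  assumes "X \<in> row_ball_level d m" "k < d"
  shows "X ! k \<in> carrier_mat m m"
  using assms by (auto simp: row_ball_level_def)

lemma row_ball_level_adjoint_le:
  assumes X: "X \<in> row_ball_level d m" and w: "w \<in> carrier_vec m"
  shows "(\<Sum>i<d. (vec_l2_norm (mat_adjoint (X ! i) *\<^sub>v w))\<^sup>2) \<le> (vec_l2_norm w)\<^sup>2"
proof -
  have "(\<Sum>i<d. (vec_l2_norm (mat_adjoint (X ! i) *\<^sub>v w))\<^sup>2)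
      \<le> mat_op_norm (mat_sum m d (\<lambda>i. X ! i * mat_adjoint (X ! i))) * (vec_l2_norm w)\<^sup>2"
    using gram_norm_lower[of d "\<lambda>i. mat_adjoint (X ! i)" m w] X w
    by (simp add: row_ball_level_carrier)
  also have "\<dots> \<le> 1 * (vec_l2_norm w)\<^sup>2"
    using X by (intro mult_right_mono) (auto simp: row_ball_level_def)
  finally show ?thesis by simp
qed

text \<open>The ball is open and its condition concerns a supremum over vectors, hence the uniform
  constant c < 1.\<close>

lemma row_ball_levelI:
  assumes "length X = d" and carr: "\<And>i. i < d \<Longrightarrow> X ! i \<in> carrier_mat m m" and c: "0 \<le> c" "c < 1"
    and le: "\<And>v. v \<in> carrier_vec m \<Longrightarrow>
      (\<Sum>i<d. (vec_l2_norm (mat_adjoint (X ! i) *\<^sub>v v))\<^sup>2) \<le> c * (vec_l2_norm v)\<^sup>2"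
  shows "X \<in> row_ball_level d m"
proof -
  have "mat_op_norm (mat_sum m d (\<lambda>i. X ! i * mat_adjoint (X ! i))) \<le> c"
    using gram_norm_upper[of d "\<lambda>i. mat_adjoint (X ! i)" m c] assms by simp
  moreover have "set X \<subseteq> carrier_mat m m"
    using assms(1) carr by (metis in_set_conv_nth subsetI)
  ultimately show ?thesis
    using assms(1) c by (simp add: row_ball_level_def)
qed

lemma zero_mat_mult_vec: "v \<in> carrier_vec k \<Longrightarrow> 0\<^sub>m m k *\<^sub>v v = 0\<^sub>v m"
  by (intro eq_vecI) auto

lemma row_ball_level_nonempty: "replicate d (0\<^sub>m 1 1) \<in> row_ball_level d 1"
proof (rule row_ball_levelI[where c = 0])
  have "mat_adjoint (0\<^sub>m 1 1 :: complex mat) = 0\<^sub>m 1 1"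
    by (rule eq_matI) auto
  then show "(\<Sum>i<d. (vec_l2_norm (mat_adjoint (replicate d (0\<^sub>m 1 1) ! i) *\<^sub>v v))\<^sup>2)
      \<le> 0 * (vec_l2_norm v)\<^sup>2" if "v \<in> carrier_vec 1" for v
    using that by (simp add: zero_mat_mult_vec)
qed auto

text \<open>Duality: membership in the ball controls the adjoints applied to a vector. Pairing the
  image w with itself moves the letters onto w, and 2xy <= x^2 + y^2 leaves p^2 + q^2, which is
  absorbed by one of the two copies of the squared norm of w. This is the only way in which the ball
  enters the column estimate.\<close>

lemma row_pair_contraction:
  assumes d: "2 \<le> d" and X: "X \<in> row_ball_level d m"
    and a: "a \<in> carrier_vec m" and b: "b \<in> carrier_vec m"
  shows "(vec_l2_norm (X ! 0 *\<^sub>v a + X ! 1 *\<^sub>v b))\<^sup>2 \<le> (vec_l2_norm a)\<^sup>2 + (vec_l2_norm b)\<^sup>2"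
proof -
  define w where "w = X ! 0 *\<^sub>v a + X ! 1 *\<^sub>v b"
  define p where "p = vec_l2_norm (mat_adjoint (X ! 0) *\<^sub>v w)"
  define q where "q = vec_l2_norm (mat_adjoint (X ! 1) *\<^sub>v w)"
  have X0: "X ! 0 \<in> carrier_mat m m" and X1: "X ! 1 \<in> carrier_mat m m"
    using d X by (auto intro: row_ball_level_carrier)
  have w: "w \<in> carrier_vec m"
    using X0 X1 a b by (simp add: w_def)
  have "p\<^sup>2 + q\<^sup>2 = (\<Sum>i\<in>{0, 1}. (vec_l2_norm (mat_adjoint (X ! i) *\<^sub>v w))\<^sup>2)"
    by (simp add: p_def q_def)
  also have "\<dots> \<le> (\<Sum>i<d. (vec_l2_norm (mat_adjoint (X ! i) *\<^sub>v w))\<^sup>2)"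
    using d by (intro sum_mono2) auto
  also have "\<dots> \<le> (vec_l2_norm w)\<^sup>2"
    by (rule row_ball_level_adjoint_le[OF X w])
  finally have pq: "p\<^sup>2 + q\<^sup>2 \<le> (vec_l2_norm w)\<^sup>2" .
  have "w \<bullet>c w = (X ! 0 *\<^sub>v a) \<bullet>c w + (X ! 1 *\<^sub>v b) \<bullet>c w"
    using X0 X1 a b w by (subst (1) w_def) (intro add_scalar_prod_distrib[of _ m], auto)
  also have "\<dots> = a \<bullet>c (mat_adjoint (X ! 0) *\<^sub>v w) + b \<bullet>c (mat_adjoint (X ! 1) *\<^sub>v w)"
    using cscalar_prod_adjoint[OF X0 a w] cscalar_prod_adjoint[OF X1 b w] by simp
  finally have "(vec_l2_norm w)\<^sup>2 =
      cmod (a \<bullet>c (mat_adjoint (X ! 0) *\<^sub>v w) + b \<bullet>c (mat_adjoint (X ! 1) *\<^sub>v w))"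
    by (metis norm_cscalar_prod_self)
  also have "\<dots> \<le> vec_l2_norm a * p + vec_l2_norm b * q"
    unfolding p_def q_def
    by (intro norm_triangle_mono cscalar_prod_le) (use X0 X1 a b in auto)
  finally have le: "(vec_l2_norm w)\<^sup>2 \<le> vec_l2_norm a * p + vec_l2_norm b * q" .
  have "2 * (vec_l2_norm w)\<^sup>2 \<le> 2 * (vec_l2_norm a * p + vec_l2_norm b * q)"
    using le by simp
  also have "\<dots> \<le> ((vec_l2_norm a)\<^sup>2 + (vec_l2_norm b)\<^sup>2) + (p\<^sup>2 + q\<^sup>2)"
    using sum_squares_bound[of "vec_l2_norm a" p] sum_squares_bound[of "vec_l2_norm b" q]
    by (simp add: algebra_simps)
  also have "\<dots> \<le> ((vec_l2_norm a)\<^sup>2 + (vec_l2_norm b)\<^sup>2) + (vec_l2_norm w)\<^sup>2"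
    using pq by simp
  finally show ?thesis
    unfolding w_def[symmetric] by simp
qed

section \<open>Row and column norms over the ball, and the upper bound\<close>

lemma H_infty_carrier:
  assumes "f \<in> H_infty d" "1 \<le> m" "X \<in> row_ball_level d m"
  shows "f X \<in> carrier_mat m m"
  using assms by (auto simp: H_infty_def nc_function_def)

lemma H_infty_bounded:
  assumes f: "f \<in> H_infty d"
  obtains K where "0 \<le> K" "\<And>m X v. 1 \<le> m \<Longrightarrow> X \<in> row_ball_level d m \<Longrightarrow> v \<in> carrier_vec m \<Longrightarrow>
    vec_l2_norm (f X *\<^sub>v v) \<le> K * vec_l2_norm v"
proof -
  obtain K where K: "\<And>X. X \<in> row_ball d \<Longrightarrow> mat_op_norm (f X) \<le> K"
    using f unfolding H_infty_def bdd_above_def by blast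
  show thesis
  \<comment> \<open>The maximum makes the constant nonnegative without exhibiting a point of the
    ball.\<close>
  proof (rule that[of "max K 0"])
    fix m X and v :: "complex vec" assume *: "1 \<le> m" "X \<in> row_ball_level d m" "v \<in> carrier_vec m"
    then have "vec_l2_norm (f X *\<^sub>v v) \<le> mat_op_norm (f X) * vec_l2_norm v"
      using H_infty_carrier[OF f *(1,2)] by (intro mat_op_norm_mult_vec) auto
    also have "mat_op_norm (f X) \<le> max K 0"
      using K[of X] * by (force simp: row_ball_def)
    finally show "vec_l2_norm (f X *\<^sub>v v) \<le> max K 0 * vec_l2_norm v"
      by (simp add: mult_right_mono)
  qed simp
qed

text \<open>The point is boundedness of the set under the supremum: bounds \<open>K i\<close> for
  the single entries give the bound sqrt(sum of \<open>K i\<close> squared) for the column.\<close>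

lemma column_norm_upper:
  assumes "\<And>i. i < n \<Longrightarrow> f i \<in> H_infty d" "1 \<le> m" "X \<in> row_ball_level d m"
  shows "sqrt (mat_op_norm (mat_sum m n (\<lambda>i. mat_adjoint (f i X) * f i X))) \<le> column_norm d n f"
proof -
  have "\<exists>K\<ge>0. \<forall>m X v. 1 \<le> m \<longrightarrow> X \<in> row_ball_level d m \<longrightarrow> v \<in> carrier_vec m \<longrightarrow>
      vec_l2_norm (f i X *\<^sub>v v) \<le> K * vec_l2_norm v" if "i < n" for i
    using H_infty_bounded[OF assms(1)[OF that]] by metis
  then obtain K where K: "\<And>i. i < n \<Longrightarrow> 0 \<le> K i"
    "\<And>i m X v. i < n \<Longrightarrow> 1 \<le> m \<Longrightarrow> X \<in> row_ball_level d m \<Longrightarrow> v \<in> carrier_vec m \<Longrightarrow>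
      vec_l2_norm (f i X *\<^sub>v v) \<le> K i * vec_l2_norm v"
    by metis
  have "sqrt (mat_op_norm (mat_sum m n (\<lambda>i. mat_adjoint (f i X) * f i X)))
      \<le> sqrt (\<Sum>i<n. (K i)\<^sup>2)" if mX: "1 \<le> m" "X \<in> row_ball_level d m" for m X
  proof (intro real_sqrt_le_mono gram_norm_upper)
    show "f i X \<in> carrier_mat m m" if "i < n" for i
      using H_infty_carrier[OF assms(1)[OF that] mX] .
    show "0 \<le> (\<Sum>i<n. (K i)\<^sup>2)"
      by (simp add: sum_nonneg)
    show "(\<Sum>i<n. (vec_l2_norm (f i X *\<^sub>v v))\<^sup>2) \<le> (\<Sum>i<n. (K i)\<^sup>2) * (vec_l2_norm v)\<^sup>2"
      if "v \<in> carrier_vec m" for v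
    proof -
      have "(\<Sum>i<n. (vec_l2_norm (f i X *\<^sub>v v))\<^sup>2) \<le> (\<Sum>i<n. (K i * vec_l2_norm v)\<^sup>2)"
        using K(2) mX that by (intro sum_mono power_mono) auto
      then show ?thesis
        by (simp add: sum_distrib_right power_mult_distrib)
    qed
  qed
  then show ?thesis
    unfolding column_norm_def using assms(2,3)
    by (intro cSup_upper bdd_aboveI[of _ "sqrt (\<Sum>i<n. (K i)\<^sup>2)"]) auto
qed

lemma row_norm_le:
  assumes "\<And>m X. 1 \<le> m \<Longrightarrow> X \<in> row_ball_level d m \<Longrightarrow>
    sqrt (mat_op_norm (mat_sum m n (\<lambda>i. f i X * mat_adjoint (f i X)))) \<le> c"
  shows "row_norm d n f \<le> c"
  unfolding row_norm_def
  by (rule cSup_least) (use row_ball_level_nonempty assms in fastforce)+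

lemma row_gram_le_column_gram:
  assumes A: "\<And>i. i < n \<Longrightarrow> A i \<in> carrier_mat m m"
  shows "mat_op_norm (mat_sum m n (\<lambda>i. A i * mat_adjoint (A i)))
    \<le> real n * mat_op_norm (mat_sum m n (\<lambda>i. mat_adjoint (A i) * A i))"
proof -
  define c where "c = mat_op_norm (mat_sum m n (\<lambda>i. mat_adjoint (A i) * A i))"
  have c: "0 \<le> c"
    by (simp add: c_def mat_op_norm_nonneg)
  have le: "vec_l2_norm (A i *\<^sub>v v) \<le> sqrt c * vec_l2_norm v"
    if i: "i < n" and v: "v \<in> carrier_vec m" for i v
  proof -
    have "(vec_l2_norm (A i *\<^sub>v v))\<^sup>2 \<le> (\<Sum>i<n. (vec_l2_norm (A i *\<^sub>v v))\<^sup>2)"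
      using i by (intro member_le_sum) auto
    also have "\<dots> \<le> c * (vec_l2_norm v)\<^sup>2"
      unfolding c_def by (rule gram_norm_lower) (use A v in auto)
    also have "\<dots> = (sqrt c * vec_l2_norm v)\<^sup>2"
      using c by (simp add: power_mult_distrib)
    finally show ?thesis
      by (rule power2_le_imp_le) (use c in simp)
  qed
  have "mat_op_norm (mat_sum m n (\<lambda>i. mat_adjoint (mat_adjoint (A i)) * mat_adjoint (A i)))
      \<le> real n * c"
  proof (rule gram_norm_upper)
    fix v :: "complex vec" assume v: "v \<in> carrier_vec m"
    have "(\<Sum>i<n. (vec_l2_norm (mat_adjoint (A i) *\<^sub>v v))\<^sup>2) \<le> (\<Sum>i<n. (sqrt c * vec_l2_norm v)\<^sup>2)"
      using A c v le by (intro sum_mono power_mono adjoint_norm_le) auto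
    then show "(\<Sum>i<n. (vec_l2_norm (mat_adjoint (A i) *\<^sub>v v))\<^sup>2) \<le> real n * c * (vec_l2_norm v)\<^sup>2"
      using c by (simp add: power_mult_distrib mult.assoc)
  qed (use A c in auto)
  then show ?thesis
    by (simp add: c_def)
qed

lemma row_gram_le_column_norm:
  assumes f: "\<And>i. i < n \<Longrightarrow> f i \<in> H_infty d" and mX: "1 \<le> m" "X \<in> row_ball_level d m"
  shows "sqrt (mat_op_norm (mat_sum m n (\<lambda>i. f i X * mat_adjoint (f i X))))
    \<le> sqrt (real n) * column_norm d n f"
proof -
  have "mat_op_norm (mat_sum m n (\<lambda>i. f i X * mat_adjoint (f i X)))
      \<le> real n * mat_op_norm (mat_sum m n (\<lambda>i. mat_adjoint (f i X) * f i X))"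
    by (intro row_gram_le_column_gram H_infty_carrier[where d = d] f mX)
  then have "sqrt (mat_op_norm (mat_sum m n (\<lambda>i. f i X * mat_adjoint (f i X))))
      \<le> sqrt (real n) * sqrt (mat_op_norm (mat_sum m n (\<lambda>i. mat_adjoint (f i X) * f i X)))"
    unfolding real_sqrt_mult[symmetric] by (rule real_sqrt_le_mono)
  also have "\<dots> \<le> sqrt (real n) * column_norm d n f"
    using f mX by (intro mult_left_mono column_norm_upper) auto
  finally show ?thesis .
qed

text \<open>Boundedness of the row values is supplied by the inequality between rows and columns
  itself.\<close>

lemma row_norm_upper:
  assumes f: "\<And>i. i < n \<Longrightarrow> f i \<in> H_infty d" and mX: "1 \<le> m" "X \<in> row_ball_level d m"
  shows "sqrt (mat_op_norm (mat_sum m n (\<lambda>i. f i X * mat_adjoint (f i X)))) \<le> row_norm d n f"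
  unfolding row_norm_def
proof (rule cSup_upper)
  show "bdd_above {sqrt (mat_op_norm (mat_sum m n (\<lambda>i. f i X * mat_adjoint (f i X)))) | m X.
      1 \<le> m \<and> X \<in> row_ball_level d m}"
    using row_gram_le_column_norm[OF f] by (intro bdd_aboveI[of _ "sqrt (real n) * column_norm d n f"]) auto
qed (use mX in blast)

lemma column_row_bound_sqrt: "column_row_bound d n (sqrt (real n))"
  unfolding column_row_bound_def by (auto intro!: row_norm_le row_gram_le_column_norm)

section \<open>Algebra of nc functions\<close>

lemma mat_dsum_four_block:
  assumes "A \<in> carrier_mat m m" "B \<in> carrier_mat k k"
  shows "mat_dsum A B = four_block_mat A (0\<^sub>m m k) (0\<^sub>m k m) B"
  using assms unfolding mat_dsum_def diag_block_mat.simps Let_def diag_block_mat_singleton[unfolded diag_block_mat.simps Let_def]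
  by simp

lemma tuple_dsum_nth:
  "X \<in> row_ball_level d m \<Longrightarrow> Y \<in> row_ball_level d k \<Longrightarrow> i < d \<Longrightarrow>
    tuple_dsum X Y ! i = mat_dsum (X ! i) (Y ! i)"
  by (simp add: tuple_dsum_def row_ball_level_def)

text \<open>The direct sum is put in block form, level by level, so that the block rules for
  products, sums and scalar multiples apply. The product S T = 1 is the one that cancels between T f
  S and T g S in the similarity rule for products.\<close>

lemma nc_functionI:
  assumes "\<And>m X. 1 \<le> m \<Longrightarrow> X \<in> row_ball_level d m \<Longrightarrow> f X \<in> carrier_mat m m"
    and "\<And>m k X Y. 1 \<le> m \<Longrightarrow> 1 \<le> k \<Longrightarrow> X \<in> row_ball_level d m \<Longrightarrow> Y \<in> row_ball_level d k \<Longrightarrow>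
      f (tuple_dsum X Y) = four_block_mat (f X) (0\<^sub>m m k) (0\<^sub>m k m) (f Y)"
    and "\<And>m X S T. 1 \<le> m \<Longrightarrow> X \<in> row_ball_level d m \<Longrightarrow> S \<in> carrier_mat m m \<Longrightarrow>
      T \<in> carrier_mat m m \<Longrightarrow> S * T = 1\<^sub>m m \<Longrightarrow> map (\<lambda>A. T * A * S) X \<in> row_ball d \<Longrightarrow>
      f (map (\<lambda>A. T * A * S) X) = T * f X * S"
  shows "nc_function d f"
  unfolding nc_function_def
proof (intro conjI allI ballI impI)
  fix X Y assume "X \<in> row_ball d" "Y \<in> row_ball d"
  then obtain m k where "1 \<le> m" "X \<in> row_ball_level d m" "1 \<le> k" "Y \<in> row_ball_level d k"
    by (auto simp: row_ball_def)
  then show "f (tuple_dsum X Y) = mat_dsum (f X) (f Y)"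
    using assms(1,2) by (simp add: mat_dsum_four_block[of _ m _ k])
next
  fix m X S T
  assume "1 \<le> m" "X \<in> row_ball_level d m" "S \<in> carrier_mat m m" "T \<in> carrier_mat m m"
    "inverts_mat S T" "map (\<lambda>A. T * A * S) X \<in> row_ball d"
  then show "f (map (\<lambda>A. T * A * S) X) = T * f X * S"
    by (intro assms(3)) (auto simp: inverts_mat_def)
qed (use assms(1) in auto)

lemma nc_function_carrier:
  "nc_function d f \<Longrightarrow> 1 \<le> m \<Longrightarrow> X \<in> row_ball_level d m \<Longrightarrow> f X \<in> carrier_mat m m"
  by (simp add: nc_function_def)

lemma nc_function_dsum:
  assumes "nc_function d f" "1 \<le> m" "1 \<le> k" "X \<in> row_ball_level d m" "Y \<in> row_ball_level d k"
  shows "f (tuple_dsum X Y) = four_block_mat (f X) (0\<^sub>m m k) (0\<^sub>m k m) (f Y)"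
proof -
  have "X \<in> row_ball d" "Y \<in> row_ball d"
    using assms by (auto simp: row_ball_def)
  then have "f (tuple_dsum X Y) = mat_dsum (f X) (f Y)"
    using assms(1) by (simp add: nc_function_def)
  then show ?thesis
    using assms by (simp add: mat_dsum_four_block[of _ m _ k] nc_function_carrier)
qed

lemma nc_function_similar:
  assumes "nc_function d f" "1 \<le> m" "X \<in> row_ball_level d m" "S \<in> carrier_mat m m"
    "T \<in> carrier_mat m m" "S * T = 1\<^sub>m m" "map (\<lambda>A. T * A * S) X \<in> row_ball d"
  shows "f (map (\<lambda>A. T * A * S) X) = T * f X * S"
proof -
  \<comment> \<open>For square matrices a one-sided inverse is two-sided.\<close>
  have "inverts_mat S T" "inverts_mat T S"
    using assms mat_mult_left_right_inverse[OF assms(4,5,6)] by (auto simp: inverts_mat_def)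
  then show ?thesis
    using assms by (simp add: nc_function_def)
qed

lemma nc_function_nth:
  assumes "k < d"
  shows "nc_function d (\<lambda>X. X ! k)"
proof (rule nc_functionI)
  show "tuple_dsum X Y ! k = four_block_mat (X ! k) (0\<^sub>m m l) (0\<^sub>m l m) (Y ! k)"
    if "X \<in> row_ball_level d m" "Y \<in> row_ball_level d l" for m l X Y
    using assms that by (simp add: tuple_dsum_nth mat_dsum_four_block row_ball_level_carrier)
  show "map (\<lambda>A. T * A * S) X ! k = T * X ! k * S" if "X \<in> row_ball_level d m" for m X S T
    using assms that by (simp add: row_ball_level_def)
qed (simp add: assms row_ball_level_carrier)

lemma nc_function_mult:
  assumes f: "nc_function d f" and g: "nc_function d g"
  shows "nc_function d (\<lambda>X. f X * g X)"
proof (rule nc_functionI)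
  show "f X * g X \<in> carrier_mat m m" if "1 \<le> m" "X \<in> row_ball_level d m" for m X
    using f g that by (intro mult_carrier_mat[of _ m m] nc_function_carrier)
  show "f (tuple_dsum X Y) * g (tuple_dsum X Y)
      = four_block_mat (f X * g X) (0\<^sub>m m k) (0\<^sub>m k m) (f Y * g Y)"
    if *: "1 \<le> m" "1 \<le> k" "X \<in> row_ball_level d m" "Y \<in> row_ball_level d k" for m k X Y
  proof -
    have c: "f X \<in> carrier_mat m m" "g X \<in> carrier_mat m m"
      "f Y \<in> carrier_mat k k" "g Y \<in> carrier_mat k k"
      using f g * by (auto intro: nc_function_carrier)
    then have c': "f X * g X \<in> carrier_mat m m" "f Y * g Y \<in> carrier_mat k k"
      by auto
    show ?thesis
      unfolding nc_function_dsum[OF f *] nc_function_dsum[OF g *]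
      by (subst mult_four_block_mat[of _ m m _ k _ k _ _ m _ k]) (use c c' in simp_all)
  qed
  show "f (map (\<lambda>A. T * A * S) X) * g (map (\<lambda>A. T * A * S) X) = T * (f X * g X) * S"
    if *: "1 \<le> m" "X \<in> row_ball_level d m" "S \<in> carrier_mat m m" "T \<in> carrier_mat m m"
      "S * T = 1\<^sub>m m" "map (\<lambda>A. T * A * S) X \<in> row_ball d" for m X S T
  proof -
    have c: "f X \<in> carrier_mat m m" "g X \<in> carrier_mat m m"
      using f g * by (auto intro: nc_function_carrier)
    have "(T * f X * S) * (T * g X * S) = T * f X * (S * T) * (g X * S)"
      using c *(3,4) by (simp add: assoc_mult_mat[of _ m m _ m _ m])
    also have "\<dots> = T * (f X * g X) * S"
      using c *(3-5) by (simp add: assoc_mult_mat[of _ m m _ m _ m])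
    finally show ?thesis
      unfolding nc_function_similar[OF f *] nc_function_similar[OF g *] .
  qed
qed

lemma nc_function_smult:
  assumes f: "nc_function d f"
  shows "nc_function d (\<lambda>X. c \<cdot>\<^sub>m f X)"
proof (rule nc_functionI)
  show "c \<cdot>\<^sub>m f X \<in> carrier_mat m m" if "1 \<le> m" "X \<in> row_ball_level d m" for m X
    using nc_function_carrier[OF f that] by simp
  show "c \<cdot>\<^sub>m f (tuple_dsum X Y) = four_block_mat (c \<cdot>\<^sub>m f X) (0\<^sub>m m k) (0\<^sub>m k m) (c \<cdot>\<^sub>m f Y)"
    if *: "1 \<le> m" "1 \<le> k" "X \<in> row_ball_level d m" "Y \<in> row_ball_level d k" for m k X Y
    unfolding nc_function_dsum[OF f *]
    using nc_function_carrier[OF f *(1,3)] nc_function_carrier[OF f *(2,4)]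
    by (subst smult_four_block_mat[of _ m m _ k _ k]) auto
  show "c \<cdot>\<^sub>m f (map (\<lambda>A. T * A * S) X) = T * (c \<cdot>\<^sub>m f X) * S"
    if *: "1 \<le> m" "X \<in> row_ball_level d m" "S \<in> carrier_mat m m" "T \<in> carrier_mat m m"
      "S * T = 1\<^sub>m m" "map (\<lambda>A. T * A * S) X \<in> row_ball d" for m X S T
    unfolding nc_function_similar[OF f *]
    using nc_function_carrier[OF f *(1,2)] *(3,4)
    by (simp add: mult_smult_distrib[of _ m m _ m] mult_smult_assoc_mat[of _ m m _ m])
qed

lemma nc_function_zero:
  assumes "1 \<le> d"
  shows "nc_function d (\<lambda>X. 0\<^sub>m (dim_row (X ! 0)) (dim_row (X ! 0)))"
proof -
  have dim: "dim_row (X ! 0) = m" if "X \<in> row_ball_level d m" for X m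
    using row_ball_level_carrier[OF that, of 0] assms by simp
  show ?thesis
  proof (rule nc_functionI)
    show "0\<^sub>m (dim_row (X ! 0)) (dim_row (X ! 0)) \<in> carrier_mat m m"
      if "X \<in> row_ball_level d m" for m X
      using dim[OF that] by simp
    show "0\<^sub>m (dim_row (tuple_dsum X Y ! 0)) (dim_row (tuple_dsum X Y ! 0)) =
        four_block_mat (0\<^sub>m (dim_row (X ! 0)) (dim_row (X ! 0))) (0\<^sub>m m k) (0\<^sub>m k m)
          (0\<^sub>m (dim_row (Y ! 0)) (dim_row (Y ! 0)))"
      if "X \<in> row_ball_level d m" "Y \<in> row_ball_level d k" for m k X Y
    proof -
      have "X ! 0 \<in> carrier_mat m m" "Y ! 0 \<in> carrier_mat k k"
        using that assms by (auto intro: row_ball_level_carrier)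
      then have "dim_row (tuple_dsum X Y ! 0) = m + k"
        using that assms by (simp add: tuple_dsum_nth mat_dsum_four_block)
      then show ?thesis
        using dim[OF that(1)] dim[OF that(2)] by (simp only: four_block_zero_mat)
    qed
    show "0\<^sub>m (dim_row (map (\<lambda>A. T * A * S) X ! 0)) (dim_row (map (\<lambda>A. T * A * S) X ! 0)) =
        T * 0\<^sub>m (dim_row (X ! 0)) (dim_row (X ! 0)) * S"
      if "X \<in> row_ball_level d m" "S \<in> carrier_mat m m" "T \<in> carrier_mat m m" for m X S T
      using that assms dim[OF that(1)] by (simp add: row_ball_level_def)
  qed
qed

lemma nc_function_add:
  assumes f: "nc_function d f" and g: "nc_function d g"
  shows "nc_function d (\<lambda>X. f X + g X)"
proof (rule nc_functionI)
  show "f X + g X \<in> carrier_mat m m" if "1 \<le> m" "X \<in> row_ball_level d m" for m X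
    using f g that by (intro add_carrier_mat nc_function_carrier)
  show "f (tuple_dsum X Y) + g (tuple_dsum X Y)
      = four_block_mat (f X + g X) (0\<^sub>m m k) (0\<^sub>m k m) (f Y + g Y)"
    if *: "1 \<le> m" "1 \<le> k" "X \<in> row_ball_level d m" "Y \<in> row_ball_level d k" for m k X Y
  proof -
    have c: "f X \<in> carrier_mat m m" "g X \<in> carrier_mat m m"
      "f Y \<in> carrier_mat k k" "g Y \<in> carrier_mat k k"
      using f g * by (auto intro: nc_function_carrier)
    show ?thesis
      unfolding nc_function_dsum[OF f *] nc_function_dsum[OF g *]
      by (subst add_four_block_mat[of _ m m _ k _ k]) (use c in simp_all)
  qed
  show "f (map (\<lambda>A. T * A * S) X) + g (map (\<lambda>A. T * A * S) X) = T * (f X + g X) * S"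
    if *: "1 \<le> m" "X \<in> row_ball_level d m" "S \<in> carrier_mat m m" "T \<in> carrier_mat m m"
      "S * T = 1\<^sub>m m" "map (\<lambda>A. T * A * S) X \<in> row_ball d" for m X S T
  proof -
    have c: "f X \<in> carrier_mat m m" "g X \<in> carrier_mat m m"
      using f g * by (auto intro: nc_function_carrier)
    then have "T * (f X + g X) * S = T * f X * S + T * g X * S"
      using *(3,4) by (simp add: mult_add_distrib_mat[of _ m m _ m] add_mult_distrib_mat[of _ m m _ _ m])
    then show ?thesis
      unfolding nc_function_similar[OF f *] nc_function_similar[OF g *] by simp
  qed
qed

section \<open>Finite sums of nc functions\<close>

text \<open>Matrices of all sizes have no common zero, so the empty sum takes its size from the
  first coordinate of the point.\<close>

primrec nc_sum :: "nat \<Rightarrow> (nat \<Rightarrow> mat_tuple \<Rightarrow> complex mat) \<Rightarrow> mat_tuple \<Rightarrow> complex mat" where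
  "nc_sum 0 f = (\<lambda>X. 0\<^sub>m (dim_row (X ! 0)) (dim_row (X ! 0)))"
| "nc_sum (Suc k) f = (\<lambda>X. nc_sum k f X + f k X)"

lemma nc_function_sum:
  assumes "1 \<le> d" "\<And>i. i < k \<Longrightarrow> nc_function d (f i)"
  shows "nc_function d (nc_sum k f)"
  using assms(2) by (induction k) (use assms(1) in \<open>auto intro!: nc_function_zero nc_function_add\<close>)

lemma nc_sum_mult_vec:
  assumes "X ! 0 \<in> carrier_mat m m" "\<And>i. i < k \<Longrightarrow> f i X \<in> carrier_mat m m"
    and v: "v \<in> carrier_vec m"
  shows "nc_sum k f X \<in> carrier_mat m m"
    and "nc_sum k f X *\<^sub>v v = vec m (\<lambda>p. \<Sum>i<k. (f i X *\<^sub>v v) $ p)"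
proof -
  have "nc_sum k f X \<in> carrier_mat m m \<and>
      nc_sum k f X *\<^sub>v v = vec m (\<lambda>p. \<Sum>i<k. (f i X *\<^sub>v v) $ p)"
    using assms(2)
  proof (induction k)
    case 0
    then show ?case
      using assms(1) v by (auto simp: zero_mat_mult_vec intro!: eq_vecI)
  next
    case (Suc k)
    then have IH: "nc_sum k f X \<in> carrier_mat m m"
      "nc_sum k f X *\<^sub>v v = vec m (\<lambda>p. \<Sum>i<k. (f i X *\<^sub>v v) $ p)"
      and k: "f k X \<in> carrier_mat m m"
      by auto
    have "nc_sum (Suc k) f X *\<^sub>v v = nc_sum k f X *\<^sub>v v + f k X *\<^sub>v v"
      using IH(1) k v by (simp add: add_mult_distrib_mat_vec[of _ m m])
    also have "\<dots> = vec m (\<lambda>p. \<Sum>i<Suc k. (f i X *\<^sub>v v) $ p)"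
      unfolding IH(2) using k by (intro eq_vecI) auto
    finally show ?case
      using IH(1) k by simp
  qed
  then show "nc_sum k f X \<in> carrier_mat m m"
    and "nc_sum k f X *\<^sub>v v = vec m (\<lambda>p. \<Sum>i<k. (f i X *\<^sub>v v) $ p)"
    by auto
qed

section \<open>The test column\<close>

abbreviation vec_sum :: "nat \<Rightarrow> nat \<Rightarrow> (nat \<Rightarrow> complex vec) \<Rightarrow> complex vec" where
  "vec_sum m k u \<equiv> vec m (\<lambda>p. \<Sum>i<k. u i $ p)"

lemma mult_mat_vec_sum:
  fixes A :: "complex mat"
  assumes "A \<in> carrier_mat m m" "\<And>i. i < k \<Longrightarrow> u i \<in> carrier_vec m"
  shows "A *\<^sub>v vec_sum m k u = vec_sum m k (\<lambda>i. A *\<^sub>v u i)"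
proof (rule eq_vecI)
  fix p assume "p < dim_vec (vec_sum m k (\<lambda>i. A *\<^sub>v u i))"
  then have p: "p < m" by simp
  have "(A *\<^sub>v vec_sum m k u) $ p = (\<Sum>q<m. \<Sum>i<k. A $$ (p, q) * u i $ q)"
    using p assms(1) by (simp add: scalar_prod_def atLeast0LessThan sum_distrib_left)
  also have "\<dots> = (\<Sum>i<k. \<Sum>q<m. A $$ (p, q) * u i $ q)"
    by (rule sum.swap)
  also have "\<dots> = vec_sum m k (\<lambda>i. A *\<^sub>v u i) $ p"
    using p assms(1) carrier_vecD[OF assms(2)]
    by (auto simp: scalar_prod_def atLeast0LessThan intro!: sum.cong)
  finally show "(A *\<^sub>v vec_sum m k u) $ p = vec_sum m k (\<lambda>i. A *\<^sub>v u i) $ p" .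
qed (use assms in auto)

lemma vec_l2_norm_lincomb_sq:
  fixes a b :: real
  assumes u: "u \<in> carrier_vec m" and s: "s \<in> carrier_vec m"
  shows "(vec_l2_norm (complex_of_real a \<cdot>\<^sub>v u + complex_of_real b \<cdot>\<^sub>v s))\<^sup>2
    = a\<^sup>2 * (vec_l2_norm u)\<^sup>2 + 2 * a * b * Re (s \<bullet>c u) + b\<^sup>2 * (vec_l2_norm s)\<^sup>2"
proof -
  have "(vec_l2_norm (complex_of_real a \<cdot>\<^sub>v u + complex_of_real b \<cdot>\<^sub>v s))\<^sup>2
      = (\<Sum>p<m. (cmod (complex_of_real a * u $ p + complex_of_real b * s $ p))\<^sup>2)"
    using u s by (auto simp: vec_l2_norm_sq intro!: sum.cong)
  also have "\<dots> = (\<Sum>p<m. a\<^sup>2 * (cmod (u $ p))\<^sup>2 + 2 * a * b * Re (s $ p * cnj (u $ p))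
      + b\<^sup>2 * (cmod (s $ p))\<^sup>2)"
    unfolding cmod_power2 by (intro sum.cong refl) (simp add: power2_eq_square algebra_simps)
  also have "\<dots> = a\<^sup>2 * (vec_l2_norm u)\<^sup>2 + 2 * a * b * Re (s \<bullet>c u) + b\<^sup>2 * (vec_l2_norm s)\<^sup>2"
    using u s by (simp add: vec_l2_norm_sq scalar_prod_def atLeast0LessThan sum.distrib
        sum_distrib_left mult.assoc del: times_complex.simps)
  finally show ?thesis .
qed

text \<open>The words \<open>x\<^sub>0\<^sup>a x\<^sub>1\<close> form a prefix code; hence so do the \<open>n\<^sup>2\<close> words \<open>y\<^sub>z\<^sub>i\<close> given by
  \<open>code_word z i\<close>, and \<open>(y\<^sub>z\<^sub>i)\<close> is a row contraction whenever \<open>X\<close> is.\<close>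

primrec shift_word :: "nat \<Rightarrow> mat_tuple \<Rightarrow> complex mat" where
  "shift_word 0 = (\<lambda>X. X ! 1)"
| "shift_word (Suc a) = (\<lambda>X. X ! 0 * shift_word a X)"

definition code_word :: "nat \<Rightarrow> nat \<Rightarrow> mat_tuple \<Rightarrow> complex mat" where
  "code_word z i X = shift_word z X * shift_word i X"

section \<open>Code words are nc functions and form row contractions\<close>

lemma nc_function_shift_word: "2 \<le> d \<Longrightarrow> nc_function d (shift_word a)"
  by (induction a) (auto intro!: nc_function_mult nc_function_nth)

lemma nc_function_code_word: "2 \<le> d \<Longrightarrow> nc_function d (code_word z i)"
  unfolding code_word_def[abs_def] by (intro nc_function_mult nc_function_shift_word)

lemma shift_word_carrier:
  assumes "2 \<le> d" "X \<in> row_ball_level d m"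
  shows "shift_word a X \<in> carrier_mat m m"
proof -
  have "X ! 0 \<in> carrier_mat m m" "X ! 1 \<in> carrier_mat m m"
    using assms by (auto intro: row_ball_level_carrier)
  then show ?thesis
    by (induction a) auto
qed

lemma code_word_carrier:
  assumes "2 \<le> d" "X \<in> row_ball_level d m"
  shows "code_word z i X \<in> carrier_mat m m"
  unfolding code_word_def using assms by (intro mult_carrier_mat[of _ m m] shift_word_carrier)

text \<open>Each letter is the pair contraction with the other entry set to zero.\<close>

lemma shift_word_contraction:
  assumes d: "2 \<le> d" and X: "X \<in> row_ball_level d m" and v: "v \<in> carrier_vec m"
  shows "(vec_l2_norm (shift_word a X *\<^sub>v v))\<^sup>2 \<le> (vec_l2_norm v)\<^sup>2"
proof (induction a)
  have X01: "X ! 0 \<in> carrier_mat m m" "X ! 1 \<in> carrier_mat m m"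
    using d X by (auto intro: row_ball_level_carrier)
  have zero: "A *\<^sub>v 0\<^sub>v m = 0\<^sub>v m" if "A \<in> carrier_mat m m" for A :: "complex mat"
    using that by (intro eq_vecI) auto
  {
    case 0
    show ?case
      using row_pair_contraction[OF d X zero_carrier_vec v] X01 v by (simp add: zero)
  next
    case (Suc a)
    have w: "shift_word a X *\<^sub>v v \<in> carrier_vec m"
      using shift_word_carrier[OF d X] v by (rule mult_mat_vec_carrier)
    have "shift_word (Suc a) X *\<^sub>v v = X ! 0 *\<^sub>v (shift_word a X *\<^sub>v v)"
      using X01 shift_word_carrier[OF d X] v by (simp add: assoc_mult_mat_vec[of _ m m _ m])
    moreover have "(vec_l2_norm (X ! 0 *\<^sub>v (shift_word a X *\<^sub>v v)))\<^sup>2 \<le> (vec_l2_norm (shift_word a X *\<^sub>v v))\<^sup>2"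
      using row_pair_contraction[OF d X w zero_carrier_vec] X01 w
      by (simp add: zero right_zero_vec[of _ m])
    ultimately show ?case
      using Suc by simp
  }
qed

text \<open>Horner's scheme: the sum of x_0^a x_1 u_a is x_0 applied to the same kind of sum for the
  shifted family, plus x_1 u_0. Thus one pair contraction is spent per peeled word; this is how the
  prefix property is used.\<close>

lemma shift_word_row_contraction:
  assumes d: "2 \<le> d" and X: "X \<in> row_ball_level d m"
    and "\<And>a. a < k \<Longrightarrow> u a \<in> carrier_vec m"
  shows "(vec_l2_norm (vec_sum m k (\<lambda>a. shift_word a X *\<^sub>v u a)))\<^sup>2 \<le> (\<Sum>a<k. (vec_l2_norm (u a))\<^sup>2)"
  using assms(3)
proof (induction k arbitrary: u)
  case 0
  have "vec m (\<lambda>p. 0) = (0\<^sub>v m :: complex vec)"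
    by (simp add: zero_vec_def)
  then show ?case by simp
next
  case (Suc k)
  have X0: "X ! 0 \<in> carrier_mat m m" and X1: "X ! 1 \<in> carrier_mat m m"
    using d X by (auto intro: row_ball_level_carrier)
  define w where "w = vec_sum m k (\<lambda>a. shift_word a X *\<^sub>v u (Suc a))"
  have carr: "shift_word a X *\<^sub>v u (Suc a) \<in> carrier_vec m" if "a < k" for a
    using shift_word_carrier[OF d X] Suc.prems that by (intro mult_mat_vec_carrier) auto
  have "X ! 0 *\<^sub>v w = vec_sum m k (\<lambda>a. X ! 0 *\<^sub>v (shift_word a X *\<^sub>v u (Suc a)))"
    unfolding w_def by (rule mult_mat_vec_sum[OF X0 carr])
  also have "\<dots> = vec_sum m k (\<lambda>a. shift_word (Suc a) X *\<^sub>v u (Suc a))"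
  proof (intro eq_vecI; simp)
    fix p assume "p < m"
    show "(\<Sum>a<k. (X ! 0 *\<^sub>v (shift_word a X *\<^sub>v u (Suc a))) $ p) =
        (\<Sum>a<k. (X ! 0 * shift_word a X *\<^sub>v u (Suc a)) $ p)"
      using Suc.prems by (intro sum.cong refl)
        (simp add: assoc_mult_mat_vec[OF X0 shift_word_carrier[OF d X]])
  qed
  finally have X0w: "X ! 0 *\<^sub>v w = vec_sum m k (\<lambda>a. shift_word (Suc a) X *\<^sub>v u (Suc a))" .
  have "vec_sum m (Suc k) (\<lambda>a. shift_word a X *\<^sub>v u a) = X ! 0 *\<^sub>v w + X ! 1 *\<^sub>v u 0"
    unfolding X0w using X1 by (intro eq_vecI) (auto simp: sum.lessThan_Suc_shift simp del: sum.lessThan_Suc)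
  then have "(vec_l2_norm (vec_sum m (Suc k) (\<lambda>a. shift_word a X *\<^sub>v u a)))\<^sup>2
      \<le> (vec_l2_norm w)\<^sup>2 + (vec_l2_norm (u 0))\<^sup>2"
    using row_pair_contraction[OF d X, of w "u 0"] Suc.prems by (simp add: w_def)
  also have "\<dots> \<le> (\<Sum>a<k. (vec_l2_norm (u (Suc a)))\<^sup>2) + (vec_l2_norm (u 0))\<^sup>2"
    unfolding w_def by (intro add_right_mono Suc.IH) (use Suc.prems in auto)
  also have "\<dots> = (\<Sum>a<Suc k. (vec_l2_norm (u a))\<^sup>2)"
    by (simp add: sum.lessThan_Suc_shift del: sum.lessThan_Suc)
  finally show ?case .
qed

lemma code_word_vec_sum:
  assumes d: "2 \<le> d" and X: "X \<in> row_ball_level d m"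
    and u: "\<And>i. i < k \<Longrightarrow> u i \<in> carrier_vec m"
  shows "vec_sum m k (\<lambda>i. code_word z i X *\<^sub>v u i)
    = shift_word z X *\<^sub>v vec_sum m k (\<lambda>i. shift_word i X *\<^sub>v u i)"
proof -
  have "shift_word i X *\<^sub>v u i \<in> carrier_vec m" if "i < k" for i
    using shift_word_carrier[OF d X] u[OF that] by (rule mult_mat_vec_carrier)
  then have "shift_word z X *\<^sub>v vec_sum m k (\<lambda>i. shift_word i X *\<^sub>v u i)
      = vec_sum m k (\<lambda>i. shift_word z X *\<^sub>v (shift_word i X *\<^sub>v u i))"
    by (intro mult_mat_vec_sum shift_word_carrier[OF d X])
  also have "\<dots> = vec_sum m k (\<lambda>i. code_word z i X *\<^sub>v u i)"
    using u by (intro eq_vecI) (auto simp: code_word_def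
        assoc_mult_mat_vec[OF shift_word_carrier[OF d X] shift_word_carrier[OF d X]])
  finally show ?thesis by simp
qed

lemma code_word_row_contraction:
  assumes d: "2 \<le> d" and X: "X \<in> row_ball_level d m"
    and u: "\<And>i. i < k \<Longrightarrow> u i \<in> carrier_vec m"
  shows "(vec_l2_norm (vec_sum m k (\<lambda>i. code_word z i X *\<^sub>v u i)))\<^sup>2 \<le> (\<Sum>i<k. (vec_l2_norm (u i))\<^sup>2)"
proof -
  have "(vec_l2_norm (vec_sum m k (\<lambda>i. code_word z i X *\<^sub>v u i)))\<^sup>2
      \<le> (vec_l2_norm (vec_sum m k (\<lambda>i. shift_word i X *\<^sub>v u i)))\<^sup>2"
    using code_word_vec_sum[OF d X, of k u z] u
      shift_word_contraction[OF d X, of "vec_sum m k (\<lambda>i. shift_word i X *\<^sub>v u i)" z] by simp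
  also have "\<dots> \<le> (\<Sum>i<k. (vec_l2_norm (u i))\<^sup>2)"
    by (rule shift_word_row_contraction[OF d X u])
  finally show ?thesis .
qed

text \<open>All n^2 words are handled at once by grouping them along their common left factor and
  using the row contraction twice. The full double family is what the trace estimate
  requires.\<close>

lemma code_word_double_row_contraction:
  assumes d: "2 \<le> d" and X: "X \<in> row_ball_level d m"
    and u: "\<And>z i. z < k \<Longrightarrow> i < k \<Longrightarrow> u z i \<in> carrier_vec m"
  shows "(vec_l2_norm (vec_sum m k (\<lambda>z. vec_sum m k (\<lambda>i. code_word z i X *\<^sub>v u z i))))\<^sup>2
    \<le> (\<Sum>z<k. \<Sum>i<k. (vec_l2_norm (u z i))\<^sup>2)"
proof -
  have "vec_sum m k (\<lambda>z. vec_sum m k (\<lambda>i. code_word z i X *\<^sub>v u z i))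
      = vec_sum m k (\<lambda>z. shift_word z X *\<^sub>v vec_sum m k (\<lambda>i. shift_word i X *\<^sub>v u z i))"
  proof (rule eq_vecI)
    fix p
    assume "p < dim_vec (vec_sum m k (\<lambda>z. shift_word z X *\<^sub>v vec_sum m k (\<lambda>i. shift_word i X *\<^sub>v u z i)))"
    then have "p < m" by simp
    moreover have "vec_sum m k (\<lambda>i. code_word z i X *\<^sub>v u z i) $ p
        = (shift_word z X *\<^sub>v vec_sum m k (\<lambda>i. shift_word i X *\<^sub>v u z i)) $ p" if "z < k" for z
      by (rule arg_cong[OF code_word_vec_sum[OF d X]]) (rule u[OF that])
    ultimately show "vec_sum m k (\<lambda>z. vec_sum m k (\<lambda>i. code_word z i X *\<^sub>v u z i)) $ p
        = vec_sum m k (\<lambda>z. shift_word z X *\<^sub>v vec_sum m k (\<lambda>i. shift_word i X *\<^sub>v u z i)) $ p"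
      by (simp del: index_mult_mat_vec)
  qed simp
  then have "(vec_l2_norm (vec_sum m k (\<lambda>z. vec_sum m k (\<lambda>i. code_word z i X *\<^sub>v u z i))))\<^sup>2
      \<le> (\<Sum>z<k. (vec_l2_norm (vec_sum m k (\<lambda>i. shift_word i X *\<^sub>v u z i)))\<^sup>2)"
    using shift_word_row_contraction[OF d X, of k "\<lambda>z. vec_sum m k (\<lambda>i. shift_word i X *\<^sub>v u z i)"]
    by simp
  also have "\<dots> \<le> (\<Sum>z<k. \<Sum>i<k. (vec_l2_norm (u z i))\<^sup>2)"
    by (intro sum_mono shift_word_row_contraction[OF d X] u) auto
  finally show ?thesis .
qed


text \<open>With \<open>Q\<close> the \<open>n \<times> n\<close> matrix of polynomials \<open>y\<^sub>z\<^sub>i / sqrt n\<close>, \<open>test_poly \<eta> n r z j\<close> is the \<open>(z, j)\<close> entry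
  of the truncated Abel mean \<open>n \<eta> (Q + (1 - \<eta>) Q\<^sup>2 + \<dots> + (1 - \<eta>)\<^bsup>r-1\<^esup> Q\<^sup>r)\<close>.\<close>

primrec test_poly :: "real \<Rightarrow> nat \<Rightarrow> nat \<Rightarrow> nat \<Rightarrow> nat \<Rightarrow> mat_tuple \<Rightarrow> complex mat" where
  "test_poly \<eta> n 0 = (\<lambda>z j. nc_sum 0 (\<lambda>i X. X ! 0))"
| "test_poly \<eta> n (Suc r) = (\<lambda>z j X. complex_of_real (sqrt n * \<eta>) \<cdot>\<^sub>m code_word z j X
     + complex_of_real ((1 - \<eta>) / sqrt n) \<cdot>\<^sub>m nc_sum n (\<lambda>i X. code_word z i X * test_poly \<eta> n r i j X) X)"

lemma nc_function_test_poly: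
  assumes "2 \<le> d"
  shows "nc_function d (test_poly \<eta> n r z j)"
proof (induction r arbitrary: z j)
  case 0
  show ?case
    using nc_function_sum[of d 0 "\<lambda>i X. X ! 0"] assms by simp
next
  case (Suc r)
  then show ?case
    using assms unfolding test_poly.simps
    by (intro nc_function_add nc_function_smult nc_function_sum nc_function_mult nc_function_code_word) auto
qed

lemma smult_mat_mult_vec:
  fixes A :: "complex mat"
  assumes "A \<in> carrier_mat m k" "v \<in> carrier_vec k"
  shows "(c \<cdot>\<^sub>m A) *\<^sub>v v = c \<cdot>\<^sub>v (A *\<^sub>v v)"
  using assms by (intro eq_vecI) (auto simp: scalar_prod_def sum_distrib_left mult.assoc)

text \<open>The Abel mean is the transfer function of a linear system whose letters feed \<open>state\<close> into \<open>out\<close>.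
  The energy of the state is at most \<open>(1 + n\<^sup>2 \<eta>)\<^sup>2\<close> times that of the input \<open>u\<close>: the only term linear in
  \<open>out\<close> is its trace, which is itself a row contraction applied to the preceding state.\<close>

locale test_poly_at =
  fixes d m n :: nat and X :: mat_tuple and \<eta> :: real and u :: "complex vec"
  assumes d: "2 \<le> d" and m: "1 \<le> m" and n: "1 \<le> n" and X: "X \<in> row_ball_level d m"
    and \<eta>: "0 < \<eta>" "\<eta> < 1" and u: "u \<in> carrier_vec m"
begin

definition out :: "nat \<Rightarrow> nat \<Rightarrow> nat \<Rightarrow> complex vec" where
  "out r z j = test_poly \<eta> n r z j X *\<^sub>v u"

text \<open>The scalars are those of n eta Q and (1 - eta) Q with the code words, equal to sqrt n
  times the entries of Q, pulled out. The input sits on the diagonal so that one application of the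
  code words reproduces both terms of the recursion for \<open>test_poly\<close>.\<close>

definition state :: "nat \<Rightarrow> nat \<Rightarrow> nat \<Rightarrow> complex vec" where
  "state r i j = complex_of_real (if i = j then sqrt n * \<eta> else 0) \<cdot>\<^sub>v u
     + complex_of_real ((1 - \<eta>) / sqrt n) \<cdot>\<^sub>v out r i j"

definition energy :: "nat \<Rightarrow> real" where
  "energy r = (\<Sum>i<n. \<Sum>j<n. (vec_l2_norm (state r i j))\<^sup>2)"

lemma test_poly_carrier: "test_poly \<eta> n r z j X \<in> carrier_mat m m"
  by (rule nc_function_carrier[OF nc_function_test_poly[OF d] m X])

lemma out_carrier: "out r z j \<in> carrier_vec m"
  unfolding out_def using test_poly_carrier u by (rule mult_mat_vec_carrier)

lemma state_carrier: "state r z j \<in> carrier_vec m"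
  unfolding state_def using out_carrier u by simp

lemma out_0: "out 0 z j = 0\<^sub>v m"
  using row_ball_level_carrier[OF X, of 0] d u by (simp add: out_def zero_mat_mult_vec)

lemma out_Suc:
  assumes j: "j < n"
  shows "out (Suc r) z j = vec_sum m n (\<lambda>i. code_word z i X *\<^sub>v state r i j)"
proof -
  let ?a = "complex_of_real (sqrt n * \<eta>)" and ?b = "complex_of_real ((1 - \<eta>) / sqrt n)"
  let ?N = "nc_sum n (\<lambda>i X. code_word z i X * test_poly \<eta> n r i j X) X"
  have cw: "code_word z i X \<in> carrier_mat m m" for i
    by (rule code_word_carrier[OF d X])
  have X0: "X ! 0 \<in> carrier_mat m m"
    using row_ball_level_carrier[OF X, of 0] d by simp
  have prod: "code_word z i X * test_poly \<eta> n r i j X \<in> carrier_mat m m" for i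
    using cw test_poly_carrier by (rule mult_carrier_mat)
  have N: "?N \<in> carrier_mat m m"
    "?N *\<^sub>v u = vec_sum m n (\<lambda>i. (code_word z i X * test_poly \<eta> n r i j X) *\<^sub>v u)"
    using nc_sum_mult_vec[where X = X and k = n and f = "\<lambda>i X. code_word z i X * test_poly \<eta> n r i j X",
        OF X0 prod u] by auto
  have "out (Suc r) z j = ?a \<cdot>\<^sub>v (code_word z j X *\<^sub>v u) + ?b \<cdot>\<^sub>v (?N *\<^sub>v u)"
    using cw[of j] N(1) u by (simp add: out_def add_mult_distrib_mat_vec[of _ m m] smult_mat_mult_vec[of _ m m])
  also have "\<dots> = vec_sum m n (\<lambda>i. code_word z i X *\<^sub>v state r i j)"
  proof (rule eq_vecI)
    fix p assume "p < dim_vec (vec_sum m n (\<lambda>i. code_word z i X *\<^sub>v state r i j))"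
    then have p: "p < m" by simp
    have "(code_word z i X *\<^sub>v state r i j) $ p = (if i = j then ?a * (code_word z j X *\<^sub>v u) $ p else 0)
        + ?b * ((code_word z i X * test_poly \<eta> n r i j X) *\<^sub>v u) $ p" for i
    proof -
      have "code_word z i X *\<^sub>v state r i j =
          complex_of_real (if i = j then sqrt n * \<eta> else 0) \<cdot>\<^sub>v (code_word z i X *\<^sub>v u)
          + ?b \<cdot>\<^sub>v (code_word z i X *\<^sub>v out r i j)"
        unfolding state_def using cw[of i] u out_carrier
        by (subst mult_add_distrib_mat_vec[of _ m m]) (auto simp: mult_mat_vec[of _ m m])
      also have "code_word z i X *\<^sub>v out r i j = (code_word z i X * test_poly \<eta> n r i j X) *\<^sub>v u"
        unfolding out_def by (rule assoc_mult_mat_vec[OF cw test_poly_carrier u, symmetric])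
      finally show ?thesis
        using p cw[of i] cw[of j] prod[of i] by (auto simp del: index_mult_mat_vec)
    qed
    then have "vec_sum m n (\<lambda>i. code_word z i X *\<^sub>v state r i j) $ p
        = ?a * (code_word z j X *\<^sub>v u) $ p
          + ?b * (\<Sum>i<n. ((code_word z i X * test_poly \<eta> n r i j X) *\<^sub>v u) $ p)"
      using p j by (simp add: sum.distrib sum_distrib_left del: index_mult_mat_vec)
    then show "(?a \<cdot>\<^sub>v (code_word z j X *\<^sub>v u) + ?b \<cdot>\<^sub>v (?N *\<^sub>v u)) $ p
        = vec_sum m n (\<lambda>i. code_word z i X *\<^sub>v state r i j) $ p"
      unfolding N(2) using p cw[of j] by (simp del: index_mult_mat_vec)
  qed (use N in auto)
  finally show ?thesis .
qed

text \<open>The input occurs only in the diagonal entries, so the cross terms see only the trace of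
  the output; in their coefficient the two factors sqrt n cancel.\<close>

lemma energy_expand:
  "energy r = (real n * \<eta> * vec_l2_norm u)\<^sup>2
     + 2 * \<eta> * (1 - \<eta>) * Re (vec_sum m n (\<lambda>i. out r i i) \<bullet>c u)
     + (1 - \<eta>)\<^sup>2 / n * (\<Sum>i<n. \<Sum>j<n. (vec_l2_norm (out r i j))\<^sup>2)"
proof -
  let ?c = "\<lambda>i j :: nat. if i = j then sqrt n * \<eta> else 0"
  have "energy r = (\<Sum>i<n. \<Sum>j<n. (?c i j)\<^sup>2 * (vec_l2_norm u)\<^sup>2
      + 2 * ?c i j * ((1 - \<eta>) / sqrt n) * Re (out r i j \<bullet>c u)
      + ((1 - \<eta>) / sqrt n)\<^sup>2 * (vec_l2_norm (out r i j))\<^sup>2)"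
    unfolding energy_def state_def
    by (intro sum.cong refl vec_l2_norm_lincomb_sq[OF u out_carrier])
  also have "\<dots> = (\<Sum>i<n. \<Sum>j<n. (if i = j then (sqrt n * \<eta>)\<^sup>2 * (vec_l2_norm u)\<^sup>2
        + 2 * \<eta> * (1 - \<eta>) * Re (out r i i \<bullet>c u) else 0)
      + (1 - \<eta>)\<^sup>2 / n * (vec_l2_norm (out r i j))\<^sup>2)"
    using n by (intro sum.cong refl) (auto simp: power_divide)
  also have "\<dots> = (\<Sum>i<n. (sqrt n * \<eta>)\<^sup>2 * (vec_l2_norm u)\<^sup>2
        + 2 * \<eta> * (1 - \<eta>) * Re (out r i i \<bullet>c u))
      + (1 - \<eta>)\<^sup>2 / n * (\<Sum>i<n. \<Sum>j<n. (vec_l2_norm (out r i j))\<^sup>2)"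
    by (simp add: sum.distrib sum_distrib_left)
  also have "(\<Sum>i<n. (sqrt n * \<eta>)\<^sup>2 * (vec_l2_norm u)\<^sup>2
        + 2 * \<eta> * (1 - \<eta>) * Re (out r i i \<bullet>c u))
      = (real n * \<eta> * vec_l2_norm u)\<^sup>2
        + 2 * \<eta> * (1 - \<eta>) * Re (\<Sum>i<n. out r i i \<bullet>c u)"
    by (simp add: sum.distrib sum_distrib_left power_mult_distrib power2_eq_square[of "real n"])
  also have "(\<Sum>i<n. out r i i \<bullet>c u) = vec_sum m n (\<lambda>i. out r i i) \<bullet>c u"
    by (rule cscalar_prod_vec_sum[OF u, symmetric])
  finally show ?thesis .
qed

text \<open>This holds for each z separately, so summing over z costs a factor n, which the squared
  factor 1/sqrt n in \<open>state\<close> compensates. A single row is exactly the column to be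
  estimated in the end.\<close>

lemma row_out_le: "(\<Sum>j<n. (vec_l2_norm (out (Suc r) z j))\<^sup>2) \<le> energy r"
proof -
  have "(\<Sum>j<n. (vec_l2_norm (out (Suc r) z j))\<^sup>2) \<le> (\<Sum>j<n. \<Sum>i<n. (vec_l2_norm (state r i j))\<^sup>2)"
    using state_carrier by (intro sum_mono) (simp add: out_Suc code_word_row_contraction[OF d X])
  then show ?thesis
    unfolding energy_def by (subst sum.swap)
qed

text \<open>In the trace every code word meets its own state entry, with indices transposed, so the
  double row contraction applies with constant 1. Estimating the n diagonal outputs separately would
  lose a factor sqrt n and spoil the limit.\<close>

lemma trace_out_le: "(vec_l2_norm (vec_sum m n (\<lambda>i. out (Suc r) i i)))\<^sup>2 \<le> energy r"
proof -
  have "vec_sum m n (\<lambda>i. out (Suc r) i i)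
      = vec_sum m n (\<lambda>z. vec_sum m n (\<lambda>i. code_word z i X *\<^sub>v state r i z))"
    by (intro eq_vecI) (auto simp: out_Suc intro!: sum.cong)
  then have "(vec_l2_norm (vec_sum m n (\<lambda>i. out (Suc r) i i)))\<^sup>2
      \<le> (\<Sum>z<n. \<Sum>i<n. (vec_l2_norm (state r i z))\<^sup>2)"
    using code_word_double_row_contraction[OF d X, of n "\<lambda>z i. state r i z"] state_carrier by simp
  then show ?thesis
    unfolding energy_def by (subst sum.swap)
qed

text \<open>The bound E is invariant under the recursion: the excess n^2 eta over the ideal constant
  1 is large enough to absorb the quadratic input term and vanishes with eta.\<close>

lemma energy_step:
  fixes E :: real
  assumes tr: "(vec_l2_norm (vec_sum m n (\<lambda>i. out r i i)))\<^sup>2 \<le> E\<^sup>2" and E: "0 \<le> E"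
    and total: "(\<Sum>i<n. \<Sum>j<n. (vec_l2_norm (out r i j))\<^sup>2) \<le> n * E\<^sup>2"
    and E_eq: "E = (1 + (real n)\<^sup>2 * \<eta>) * vec_l2_norm u"
  shows "energy r \<le> E\<^sup>2"
proof -
  define U where "U = vec_l2_norm u"
  define \<delta> where "\<delta> = (real n)\<^sup>2 * \<eta>"
  have \<delta>: "0 \<le> \<delta>" and E_eq': "E = (1 + \<delta>) * U" and U: "0 \<le> U"
    using \<eta> E_eq by (auto simp: \<delta>_def U_def)
  have "Re (vec_sum m n (\<lambda>i. out r i i) \<bullet>c u) \<le> cmod (vec_sum m n (\<lambda>i. out r i i) \<bullet>c u)"
    by (rule complex_Re_le_cmod)
  also have "\<dots> \<le> vec_l2_norm (vec_sum m n (\<lambda>i. out r i i)) * U"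
    unfolding U_def using u by (intro cscalar_prod_le) simp
  also have "\<dots> \<le> E * U"
    using power2_le_imp_le[OF tr E] U by (intro mult_right_mono) auto
  finally have "2 * \<eta> * (1 - \<eta>) * Re (vec_sum m n (\<lambda>i. out r i i) \<bullet>c u) \<le> 2 * \<eta> * (1 - \<eta>) * (E * U)"
    using \<eta> by (intro mult_left_mono) auto
  moreover have "(1 - \<eta>)\<^sup>2 / n * (\<Sum>i<n. \<Sum>j<n. (vec_l2_norm (out r i j))\<^sup>2) \<le> (1 - \<eta>)\<^sup>2 / n * (n * E\<^sup>2)"
    using total by (intro mult_left_mono) auto
  moreover have "(1 - \<eta>)\<^sup>2 / n * (n * E\<^sup>2) = (1 - \<eta>)\<^sup>2 * E\<^sup>2"
    using n by simp
  ultimately have "energy r \<le> (real n * \<eta> * U)\<^sup>2 + 2 * \<eta> * (1 - \<eta>) * (E * U) + (1 - \<eta>)\<^sup>2 * E\<^sup>2"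
    unfolding energy_expand[of r] U_def[symmetric] by linarith
  \<comment> \<open>Here n^2 eta^2 is eta \<delta>, and expanding with E = (1 + \<delta>) U leaves a
    subtracted term that is visibly nonnegative.\<close>
  also have "\<dots> = E\<^sup>2 - \<eta> * U\<^sup>2 * (\<eta> + \<delta> + (2 - \<eta>) * \<delta>\<^sup>2)"
    unfolding E_eq' \<delta>_def by (simp add: power2_eq_square algebra_simps)
  also have "\<dots> \<le> E\<^sup>2"
    using \<eta> \<delta> by simp
  finally show ?thesis .
qed

lemma energy_le: "energy r \<le> ((1 + (real n)\<^sup>2 * \<eta>) * vec_l2_norm u)\<^sup>2"
proof (induction r)
  case 0
  \<comment> \<open>With zero output the hypotheses on trace and total are trivial, so the base case
    is an instance of the same step.\<close>
  have "vec m (\<lambda>p. \<Sum>i<n. 0\<^sub>v m $ p) = (0\<^sub>v m :: complex vec)"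
    by (intro eq_vecI) auto
  then show ?case
    using \<eta> by (intro energy_step) (auto simp: out_0)
next
  case (Suc r)
  show ?case
  proof (rule energy_step)
    show "(vec_l2_norm (vec_sum m n (\<lambda>i. out (Suc r) i i)))\<^sup>2
        \<le> ((1 + (real n)\<^sup>2 * \<eta>) * vec_l2_norm u)\<^sup>2"
      using trace_out_le Suc by (rule order_trans)
    have "(\<Sum>i<n. \<Sum>j<n. (vec_l2_norm (out (Suc r) i j))\<^sup>2)
        \<le> (\<Sum>i<n. ((1 + (real n)\<^sup>2 * \<eta>) * vec_l2_norm u)\<^sup>2)"
      using Suc by (intro sum_mono order_trans[OF row_out_le])
    then show "(\<Sum>i<n. \<Sum>j<n. (vec_l2_norm (out (Suc r) i j))\<^sup>2)
        \<le> real n * ((1 + (real n)\<^sup>2 * \<eta>) * vec_l2_norm u)\<^sup>2"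
      by simp
  qed (use \<eta> in simp_all)
qed

end

lemma test_poly_column_le:
  assumes "2 \<le> d" "1 \<le> m" "1 \<le> n" "X \<in> row_ball_level d m" "0 < \<eta>" "\<eta> < 1" "u \<in> carrier_vec m"
  shows "(\<Sum>j<n. (vec_l2_norm (test_poly \<eta> n (Suc r) z j X *\<^sub>v u))\<^sup>2)
    \<le> (1 + (real n)\<^sup>2 * \<eta>)\<^sup>2 * (vec_l2_norm u)\<^sup>2"
proof -
  interpret test_poly_at d m n X \<eta> u
    using assms by unfold_locales
  show ?thesis
    using order_trans[OF row_out_le energy_le] unfolding out_def power_mult_distrib .
qed

section \<open>A point where the row is large\<close>

lemma mat_adjoint_mult:
  fixes A B :: "complex mat"
  assumes "A \<in> carrier_mat m k" "B \<in> carrier_mat k l"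
  shows "mat_adjoint (A * B) = mat_adjoint B * mat_adjoint A"
  using assms by (intro eq_matI) (auto simp: scalar_prod_def mult.commute)

lemma mat_adjoint_add:
  fixes A B :: "complex mat"
  assumes "A \<in> carrier_mat m k" "B \<in> carrier_mat m k"
  shows "mat_adjoint (A + B) = mat_adjoint A + mat_adjoint B"
  using assms by (intro eq_matI) auto

lemma mat_adjoint_smult: "mat_adjoint (c \<cdot>\<^sub>m A) = cnj c \<cdot>\<^sub>m mat_adjoint A"
  by (rule eq_matI) auto

section \<open>Weighted shifts and the test point\<close>

lemma mult_unit_vec_index:
  fixes A :: "complex mat"
  assumes "A \<in> carrier_mat m k" "p < m" "q < k"
  shows "(A *\<^sub>v unit_vec k q) $ p = A $$ (p, q)"
  using assms by simp

text \<open>Laid out so that the adjoint is the walk sending vertex p to t p with weight w p: both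
  the ball condition and the row norm are read off from adjoints.\<close>

definition weighted_shift :: "nat \<Rightarrow> (nat \<Rightarrow> nat) \<Rightarrow> (nat \<Rightarrow> real) \<Rightarrow> complex mat" where
  "weighted_shift m t w = mat m m (\<lambda>(p, q). if q = t p then complex_of_real (w p) else 0)"

lemma weighted_shift_carrier [simp]: "weighted_shift m t w \<in> carrier_mat m m"
  by (simp add: weighted_shift_def)

lemma weighted_shift_adjoint_unit_vec:
  assumes "k < m"
  shows "mat_adjoint (weighted_shift m t w) *\<^sub>v unit_vec m k = complex_of_real (w k) \<cdot>\<^sub>v unit_vec m (t k)"
proof (rule eq_vecI)
  fix p assume "p < dim_vec (complex_of_real (w k) \<cdot>\<^sub>v unit_vec m (t k) :: complex vec)"
  then have p: "p < m" by simp
  then have "(mat_adjoint (weighted_shift m t w) *\<^sub>v unit_vec m k) $ p = mat_adjoint (weighted_shift m t w) $$ (p, k)"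
    using assms by (intro mult_unit_vec_index[of _ m]) auto
  also have "\<dots> = (complex_of_real (w k) \<cdot>\<^sub>v unit_vec m (t k)) $ p"
    using assms p by (auto simp: weighted_shift_def unit_vec_def)
  finally show "(mat_adjoint (weighted_shift m t w) *\<^sub>v unit_vec m k) $ p = (complex_of_real (w k) \<cdot>\<^sub>v unit_vec m (t k)) $ p" .
qed (simp add: weighted_shift_def)

text \<open>Injectivity where the weight is nonzero makes the images of the basis vectors
  orthogonal. It is an inequality because a target may lie outside the m vertices, and its
  contribution is then lost.\<close>

lemma weighted_shift_adjoint_norm_le:
  assumes inj: "inj_on t {p. p < m \<and> w p \<noteq> 0}" and v: "v \<in> carrier_vec m"
  shows "(vec_l2_norm (mat_adjoint (weighted_shift m t w) *\<^sub>v v))\<^sup>2 \<le> (\<Sum>p<m. (w p)\<^sup>2 * (cmod (v $ p))\<^sup>2)"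
proof -
  let ?S = "{p. p < m \<and> w p \<noteq> 0}"
  let ?c = "\<lambda>p. complex_of_real (w p) * v $ p"
  have fibre: "(cmod (\<Sum>p | p \<in> ?S \<and> t p = q. ?c p))\<^sup>2 = (\<Sum>p | p \<in> ?S \<and> t p = q. (cmod (?c p))\<^sup>2)" for q
  proof (cases "\<exists>p\<in>?S. t p = q")
    case True
    then obtain p where "p \<in> ?S" "t p = q" by blast
    then have "{p \<in> ?S. t p = q} = {p}"
      using inj by (auto dest: inj_onD)
    then show ?thesis by simp
  next
    case False
    then have "{p \<in> ?S. t p = q} = {}" by blast
    then show ?thesis by (simp only: sum.empty) simp
  qed
  have "(mat_adjoint (weighted_shift m t w) *\<^sub>v v) $ q = (\<Sum>p | p \<in> ?S \<and> t p = q. ?c p)"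
    if q: "q < m" for q
  proof -
    have "(mat_adjoint (weighted_shift m t w) *\<^sub>v v) $ q = (\<Sum>p<m. if q = t p then ?c p else 0)"
      using q v by (auto simp: weighted_shift_def scalar_prod_def atLeast0LessThan intro!: sum.cong)
    also have "\<dots> = (\<Sum>p | p \<in> ?S \<and> t p = q. ?c p)"
      by (rule sum.mono_neutral_cong_right) auto
    finally show ?thesis .
  qed
  then have "(vec_l2_norm (mat_adjoint (weighted_shift m t w) *\<^sub>v v))\<^sup>2
      = (\<Sum>q<m. \<Sum>p | p \<in> ?S \<and> t p = q. (cmod (?c p))\<^sup>2)"
    using fibre by (auto simp: vec_l2_norm_sq weighted_shift_def simp del: index_mult_mat_vec intro!: sum.cong)
  \<comment> \<open>Adding all targets to the index set lets the sum be regrouped by fibres.\<close>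
  also have "\<dots> \<le> (\<Sum>q\<in>{..<m} \<union> t ` ?S. \<Sum>p | p \<in> ?S \<and> t p = q. (cmod (?c p))\<^sup>2)"
    by (intro sum_mono2) (auto intro: sum_nonneg)
  also have "\<dots> = (\<Sum>p\<in>?S. (cmod (?c p))\<^sup>2)"
    by (rule sum.group) auto
  also have "\<dots> = (\<Sum>p<m. (w p)\<^sup>2 * (cmod (v $ p))\<^sup>2)"
    by (rule sum.mono_neutral_cong_left) (auto simp: norm_mult power_mult_distrib)
  finally show ?thesis .
qed

text \<open>The adjoints of the test point walk on \<open>2n\<close> vertices. From a vertex \<open>k < n\<close> the only word
  \<open>x\<^sub>0\<^sup>a x\<^sub>1\<close> that survives is \<open>a = k\<close>, and it leads to the vertex \<open>n\<close>; from there \<open>x\<^sub>0\<^sup>a x\<^sub>1\<close> leads to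
  \<open>a\<close>, with weights chosen so that the product along each of the \<open>n\<close> paths is \<open>1 / sqrt n\<close> up to powers
  of \<open>r\<close>. For \<open>r = 1\<close>, compression to the first \<open>n\<close> vertices gives \<open>y\<^sub>z\<^sub>i = E\<^sub>z\<^sub>i / sqrt n\<close>, where \<open>Q\<close> is a projection; \<open>r < 1\<close> makes the
  row contraction strict.\<close>

definition step_target :: "nat \<Rightarrow> nat \<Rightarrow> nat" where
  "step_target n k = (if k < n then k - 1 else k + 1)"

text \<open>For r = 1 the squares are probabilities of a uniform choice among n, made sequentially:
  at vertex k >= n there remain 2n - k candidates, the jump selects the current one with probability
  1/(2n - k), and the step passes on to the next. At the last vertex the jump is certain.\<close>

definition step_weight :: "nat \<Rightarrow> real \<Rightarrow> nat \<Rightarrow> real" where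
  "step_weight n r k = (if k = 0 then 0 else if k < n then r
     else if k < 2 * n - 1 then r * sqrt (1 - 1 / real (2 * n - k)) else 0)"

definition jump_target :: "nat \<Rightarrow> nat \<Rightarrow> nat" where
  "jump_target n k = (if k = 0 then n else k - n)"

definition jump_weight :: "nat \<Rightarrow> real \<Rightarrow> nat \<Rightarrow> real" where
  "jump_weight n r k = (if k = 0 then r else if k < n then 0 else r / sqrt (real (2 * n - k)))"

definition test_point :: "nat \<Rightarrow> nat \<Rightarrow> real \<Rightarrow> mat_tuple" where
  "test_point d n r =
     [weighted_shift (2 * n) (step_target n) (step_weight n r),
      weighted_shift (2 * n) (jump_target n) (jump_weight n r)]
     @ replicate (d - 2) (0\<^sub>m (2 * n) (2 * n))"

text \<open>Outgoing probabilities add up to 1, scaled by r^2; hence the test point is r times a row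
  coisometry.\<close>

lemma test_point_weights:
  assumes "1 \<le> n" "k < 2 * n"
  shows "(step_weight n r k)\<^sup>2 + (jump_weight n r k)\<^sup>2 = r\<^sup>2"
proof -
  consider "k = 0" | "0 < k" "k < n" | "n \<le> k" "k < 2 * n - 1" | "k = 2 * n - 1" "n \<le> k" "k \<noteq> 0"
    using assms by linarith
  then show ?thesis
  proof cases
    case 3
    define x where "x = real (2 * n - k)"
    have x: "1 < x" using 3 by (simp add: x_def)
    then have "(r * sqrt (1 - 1 / x))\<^sup>2 + (r / sqrt x)\<^sup>2 = r\<^sup>2"
      by (simp add: power_mult_distrib power_divide field_simps)
    then show ?thesis
      using 3 assms by (simp add: step_weight_def jump_weight_def x_def)
  qed (use assms in \<open>auto simp: step_weight_def jump_weight_def\<close>)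
qed

lemma test_point_in_ball:
  assumes d: "2 \<le> d" and n: "1 \<le> n" and r: "0 < r" "r < 1"
  shows "test_point d n r \<in> row_ball_level d (2 * n)"
proof (rule row_ball_levelI[where c = "r\<^sup>2"])
  let ?X = "test_point d n r"
  show "length ?X = d"
    using d by (simp add: test_point_def)
  show "?X ! i \<in> carrier_mat (2 * n) (2 * n)" if "i < d" for i
    using that by (auto simp: test_point_def nth_append nth_Cons' less_Suc_eq)
  show "r\<^sup>2 < 1"
    using r by (simp add: power_less_one_iff)
  fix v :: "complex vec" assume v: "v \<in> carrier_vec (2 * n)"
  obtain d' where d': "d = Suc (Suc d')"
    using d by (metis add_2_eq_Suc le_Suc_ex)
  have zero: "mat_adjoint (0\<^sub>m (2 * n) (2 * n)) = (0\<^sub>m (2 * n) (2 * n) :: complex mat)"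
    by (rule eq_matI) auto
  have "(\<Sum>i<d. (vec_l2_norm (mat_adjoint (?X ! i) *\<^sub>v v))\<^sup>2)
      = (vec_l2_norm (mat_adjoint (?X ! 0) *\<^sub>v v))\<^sup>2 + (vec_l2_norm (mat_adjoint (?X ! 1) *\<^sub>v v))\<^sup>2"
    using v by (simp add: d' sum.lessThan_Suc_shift test_point_def zero zero_mat_mult_vec del: sum.lessThan_Suc)
  also have "\<dots> \<le> (\<Sum>p<2*n. (step_weight n r p)\<^sup>2 * (cmod (v $ p))\<^sup>2)
      + (\<Sum>p<2*n. (jump_weight n r p)\<^sup>2 * (cmod (v $ p))\<^sup>2)"
  proof (rule add_mono)
    \<comment> \<open>The lower half moves down and the upper half moves up without leaving its
      half, since vertex 0 and the last vertex carry step weight 0.\<close>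
    have "inj_on (step_target n) {p. p < 2 * n \<and> step_weight n r p \<noteq> 0}"
      by (rule inj_onI) (auto simp: step_target_def step_weight_def split: if_splits)
    from weighted_shift_adjoint_norm_le[OF this v]
    show "(vec_l2_norm (mat_adjoint (?X ! 0) *\<^sub>v v))\<^sup>2
        \<le> (\<Sum>p<2*n. (step_weight n r p)\<^sup>2 * (cmod (v $ p))\<^sup>2)"
      by (simp add: test_point_def)
    have "inj_on (jump_target n) {p. p < 2 * n \<and> jump_weight n r p \<noteq> 0}"
      by (rule inj_onI) (auto simp: jump_target_def jump_weight_def split: if_splits)
    from weighted_shift_adjoint_norm_le[OF this v]
    show "(vec_l2_norm (mat_adjoint (?X ! 1) *\<^sub>v v))\<^sup>2
        \<le> (\<Sum>p<2*n. (jump_weight n r p)\<^sup>2 * (cmod (v $ p))\<^sup>2)"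
      by (simp add: test_point_def)
  qed
  also have "\<dots> = (\<Sum>p<2*n. r\<^sup>2 * (cmod (v $ p))\<^sup>2)"
    unfolding sum.distrib[symmetric]
    by (intro sum.cong refl) (simp add: distrib_right[symmetric] test_point_weights[OF n])
  also have "\<dots> = r\<^sup>2 * (vec_l2_norm v)\<^sup>2"
    using v by (simp add: vec_l2_norm_sq sum_distrib_left)
  finally show "(\<Sum>i<d. (vec_l2_norm (mat_adjoint (?X ! i) *\<^sub>v v))\<^sup>2) \<le> r\<^sup>2 * (vec_l2_norm v)\<^sup>2" .
qed simp

section \<open>Values of the test polynomials at the test point\<close>

lemma nc_sum_adjoint_mult_vec:
  assumes "X ! 0 \<in> carrier_mat m m" "\<And>i. i < k \<Longrightarrow> f i X \<in> carrier_mat m m"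
    and v: "v \<in> carrier_vec m"
  shows "mat_adjoint (nc_sum k f X) *\<^sub>v v = vec_sum m k (\<lambda>i. mat_adjoint (f i X) *\<^sub>v v)"
  using assms(2)
proof (induction k)
  case 0
  have "mat_adjoint (0\<^sub>m m m) = (0\<^sub>m m m :: complex mat)"
    by (rule eq_matI) auto
  then show ?case
    using assms(1) v by (auto simp: zero_mat_mult_vec intro!: eq_vecI)
next
  case (Suc k)
  have s: "nc_sum k f X \<in> carrier_mat m m"
    by (rule nc_sum_mult_vec(1)[OF assms(1) _ v]) (use Suc.prems in simp)
  have k: "f k X \<in> carrier_mat m m"
    using Suc.prems by simp
  have "mat_adjoint (nc_sum (Suc k) f X) *\<^sub>v v = mat_adjoint (nc_sum k f X) *\<^sub>v v + mat_adjoint (f k X) *\<^sub>v v"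
    using s k v by (simp add: mat_adjoint_add[of _ m m] add_mult_distrib_mat_vec[of _ m m])
  also have "mat_adjoint (nc_sum k f X) *\<^sub>v v = vec_sum m k (\<lambda>i. mat_adjoint (f i X) *\<^sub>v v)"
    by (rule Suc.IH) (use Suc.prems in simp)
  also have "\<dots> + mat_adjoint (f k X) *\<^sub>v v = vec_sum m (Suc k) (\<lambda>i. mat_adjoint (f i X) *\<^sub>v v)"
    using k by (intro eq_vecI) auto
  finally show ?case .
qed

text \<open>This is the scalar left in the (z, j) entry of the Abel mean at the test point once r^(z
  + j) is split off. The factor r^2 comes from the two letters x_1 of a code word, the average of
  r^(2 i) from the intermediate index. At r = 1 it is the total weight of the truncated
  mean.\<close>

primrec gain :: "real \<Rightarrow> nat \<Rightarrow> real \<Rightarrow> nat \<Rightarrow> real" where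
  "gain \<eta> n r 0 = 0"
| "gain \<eta> n r (Suc R) = r\<^sup>2 * (\<eta> + (1 - \<eta>) * ((\<Sum>i<n. r ^ (2 * i)) / n) * gain \<eta> n r R)"

context
  fixes d n :: nat and r :: real
  assumes d: "2 \<le> d" and n: "1 \<le> n" and r: "0 < r" "r < 1"
begin

private abbreviation "Z \<equiv> test_point d n r"
private abbreviation "e \<equiv> (unit_vec (2 * n) :: nat \<Rightarrow> complex vec)"

private lemma Z_ball: "Z \<in> row_ball_level d (2 * n)"
  by (rule test_point_in_ball[OF d n r])

private lemma Z_0_adjoint: "k < 2 * n \<Longrightarrow>
    mat_adjoint (Z ! 0) *\<^sub>v e k = complex_of_real (step_weight n r k) \<cdot>\<^sub>v e (step_target n k)"
  by (simp add: test_point_def weighted_shift_adjoint_unit_vec)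

private lemma Z_1_adjoint: "k < 2 * n \<Longrightarrow>
    mat_adjoint (Z ! 1) *\<^sub>v e k = complex_of_real (jump_weight n r k) \<cdot>\<^sub>v e (jump_target n k)"
  by (simp add: test_point_def weighted_shift_adjoint_unit_vec)

private lemma word_carrier: "shift_word a Z \<in> carrier_mat (2 * n) (2 * n)"
  by (rule shift_word_carrier[OF d Z_ball])

private lemma smult_adjoint_mult_vec:
  assumes "A \<in> carrier_mat (2 * n) (2 * n)"
  shows "mat_adjoint A *\<^sub>v (c \<cdot>\<^sub>v e k) = c \<cdot>\<^sub>v (mat_adjoint A *\<^sub>v e k)"
  by (rule mult_mat_vec[of _ "2 * n" "2 * n"]) (use assms in auto)

private lemma shift_word_Suc_adjoint:
  assumes "k < 2 * n"
  shows "mat_adjoint (shift_word (Suc a) Z) *\<^sub>v e k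
    = complex_of_real (step_weight n r k) \<cdot>\<^sub>v (mat_adjoint (shift_word a Z) *\<^sub>v e (step_target n k))"
proof -
  have X0: "Z ! 0 \<in> carrier_mat (2 * n) (2 * n)"
    using row_ball_level_carrier[OF Z_ball, of 0] d by simp
  have "mat_adjoint (shift_word (Suc a) Z) *\<^sub>v e k
      = mat_adjoint (shift_word a Z) *\<^sub>v (mat_adjoint (Z ! 0) *\<^sub>v e k)"
    using X0 word_carrier[of a]
    by (simp add: mat_adjoint_mult[of _ "2 * n" "2 * n" _ "2 * n"] assoc_mult_mat_vec[of _ "2 * n" "2 * n" _ "2 * n"])
  then show ?thesis
    unfolding Z_0_adjoint[OF assms] smult_adjoint_mult_vec[OF word_carrier] .
qed

text \<open>Under adjoints the leftmost letter acts first. Below n each x_0 counts down by one and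
  x_1 survives only at vertex 0, so the word must have exactly k letters x_0.\<close>

private lemma shift_word_adjoint_first:
  assumes "k < n"
  shows "mat_adjoint (shift_word a Z) *\<^sub>v e k = complex_of_real (if k = a then r ^ Suc a else 0) \<cdot>\<^sub>v e n"
  using assms
proof (induction a arbitrary: k)
  case 0
  then show ?case
    using Z_1_adjoint[of k] by (auto simp: jump_weight_def jump_target_def)
next
  case (Suc a)
  show ?case
  proof (cases k)
    case 0
    then show ?thesis
      using shift_word_Suc_adjoint[of 0 a] n word_carrier[of a] by (auto simp: step_weight_def)
  next
    case (Suc l)
    then show ?thesis
      using shift_word_Suc_adjoint[of k a] Suc.IH[of l] Suc.prems
      by (auto simp: step_weight_def step_target_def smult_smult_assoc)
  qed
qed

text \<open>The weights telescope: with x candidates left, sqrt((x - 1)/x) times 1/sqrt(x - 1) is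
  1/sqrt x, so every reachable vertex has the same weight up to powers of r.\<close>

private lemma shift_word_adjoint_second:
  assumes "a + j < n"
  shows "mat_adjoint (shift_word a Z) *\<^sub>v e (n + j)
    = complex_of_real (r ^ Suc a / sqrt (real (n - j))) \<cdot>\<^sub>v e (a + j)"
  using assms
proof (induction a arbitrary: j)
  case 0
  then show ?case
    using Z_1_adjoint[of "n + j"] by (simp add: jump_weight_def jump_target_def)
next
  case (Suc a)
  define x where "x = real (n - j)"
  have x: "1 < x" "real (n - Suc j) = x - 1"
    using Suc.prems by (auto simp: x_def)
  have w: "step_weight n r (n + j) = r * sqrt (1 - 1 / x)"
    using Suc.prems by (auto simp: step_weight_def x_def)
  have "1 - 1 / x = (x - 1) / x"
    using x by (simp add: field_simps)
  then have "r * sqrt (1 - 1 / x) * (r ^ Suc a / sqrt (x - 1)) = r ^ Suc (Suc a) / sqrt x"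
    using x by (simp add: real_sqrt_divide)
  then have "step_weight n r (n + j) * (r ^ Suc a / sqrt (real (n - Suc j))) = r ^ Suc (Suc a) / sqrt (real (n - j))"
    unfolding w x(2) by (simp add: x_def)
  then have weights: "complex_of_real (step_weight n r (n + j)) * complex_of_real (r ^ Suc a / sqrt (real (n - Suc j)))
      = complex_of_real (r ^ Suc (Suc a) / sqrt (real (n - j)))"
    by (simp only: of_real_mult[symmetric])
  have IH: "mat_adjoint (shift_word a Z) *\<^sub>v e (n + Suc j)
      = complex_of_real (r ^ Suc a / sqrt (real (n - Suc j))) \<cdot>\<^sub>v e (a + Suc j)"
    by (rule Suc.IH) (use Suc.prems in simp)
  have "mat_adjoint (shift_word (Suc a) Z) *\<^sub>v e (n + j) = complex_of_real (step_weight n r (n + j)) \<cdot>\<^sub>v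
      (mat_adjoint (shift_word a Z) *\<^sub>v e (n + Suc j))"
    using shift_word_Suc_adjoint[of "n + j" a] Suc.prems by (simp add: step_target_def)
  then show ?case
    unfolding IH smult_smult_assoc weights by simp
qed

text \<open>The left factor tests for vertex z and the right factor writes i. The span of the first
  n basis vectors is thus invariant under these adjoints, so products of code words can be evaluated
  inside it.\<close>

private lemma code_word_adjoint:
  assumes "k < n" "i < n"
  shows "mat_adjoint (code_word z i Z) *\<^sub>v e k
    = complex_of_real (if k = z then r ^ (z + i + 2) / sqrt n else 0) \<cdot>\<^sub>v e i"
proof -
  have "mat_adjoint (code_word z i Z) *\<^sub>v e k
      = mat_adjoint (shift_word i Z) *\<^sub>v (mat_adjoint (shift_word z Z) *\<^sub>v e k)"
    using word_carrier[of z] word_carrier[of i] unfolding code_word_def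
    by (simp add: mat_adjoint_mult[of _ "2 * n" "2 * n" _ "2 * n"] assoc_mult_mat_vec[of _ "2 * n" "2 * n" _ "2 * n"])
  also have "\<dots> = complex_of_real (if k = z then r ^ Suc z else 0) \<cdot>\<^sub>v
      (complex_of_real (r ^ Suc i / sqrt n) \<cdot>\<^sub>v e i)"
    unfolding shift_word_adjoint_first[OF assms(1)] smult_adjoint_mult_vec[OF word_carrier]
    using shift_word_adjoint_second[of i 0] assms by simp
  finally show ?thesis
    by (auto simp: smult_smult_assoc power_add power2_eq_square mult_ac)
qed

private lemma test_poly_adjoint:
  assumes "k < n" "j < n" and \<eta>: "0 < \<eta>" "\<eta> < 1"
  shows "mat_adjoint (test_poly \<eta> n R z j Z) *\<^sub>v e k
    = complex_of_real (if k = z then gain \<eta> n r R * r ^ (z + j) else 0) \<cdot>\<^sub>v e j"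
  using assms(1,2)
proof (induction R arbitrary: k z j)
  case 0
  have "Z ! 0 \<in> carrier_mat (2 * n) (2 * n)"
    using row_ball_level_carrier[OF Z_ball, of 0] d by simp
  moreover have "mat_adjoint (0\<^sub>m (2 * n) (2 * n)) = (0\<^sub>m (2 * n) (2 * n) :: complex mat)"
    by (rule eq_matI) auto
  ultimately show ?case
    by (auto simp: zero_mat_mult_vec)
next
  case (Suc R)
  let ?M = "2 * n"
  let ?g = "gain \<eta> n r R"
  let ?\<delta> = "if k = z then 1 else 0 :: real"
  define N where "N = nc_sum n (\<lambda>i X. code_word z i X * test_poly \<eta> n R i j X) Z"
  have M: "1 \<le> ?M" using n by simp
  have X0: "Z ! 0 \<in> carrier_mat ?M ?M"
    using row_ball_level_carrier[OF Z_ball, of 0] d by simp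
  have cw: "code_word z i Z \<in> carrier_mat ?M ?M" for i
    by (rule code_word_carrier[OF d Z_ball])
  have tp: "test_poly \<eta> n R i j Z \<in> carrier_mat ?M ?M" for i
    by (rule nc_function_carrier[OF nc_function_test_poly[OF d] M Z_ball])
  have prod: "code_word z i Z * test_poly \<eta> n R i j Z \<in> carrier_mat ?M ?M" for i
    using cw tp by (rule mult_carrier_mat)
  have N: "N \<in> carrier_mat ?M ?M"
    unfolding N_def by (rule nc_sum_mult_vec(1)[where X = Z and k = n and f = "\<lambda>i X. code_word z i X * test_poly \<eta> n R i j X",
          OF X0 prod unit_vec_carrier])
  have prod_adjoint: "mat_adjoint (code_word z i Z * test_poly \<eta> n R i j Z) *\<^sub>v e k
      = complex_of_real (?\<delta> * (r ^ (z + i + 2) / sqrt n) * (?g * r ^ (i + j))) \<cdot>\<^sub>v e j" if i: "i < n" for i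
  proof -
    have "mat_adjoint (code_word z i Z * test_poly \<eta> n R i j Z) *\<^sub>v e k
        = mat_adjoint (test_poly \<eta> n R i j Z) *\<^sub>v (mat_adjoint (code_word z i Z) *\<^sub>v e k)"
      unfolding mat_adjoint_mult[OF cw tp]
      by (rule assoc_mult_mat_vec[of _ ?M ?M _ ?M]) (use cw tp in auto)
    also have "\<dots> = complex_of_real (if k = z then r ^ (z + i + 2) / sqrt n else 0) \<cdot>\<^sub>v
        (complex_of_real (?g * r ^ (i + j)) \<cdot>\<^sub>v e j)"
      unfolding code_word_adjoint[OF Suc.prems(1) i] smult_adjoint_mult_vec[OF tp]
      using Suc.IH[OF i Suc.prems(2), of i] by simp
    also have "\<dots> = complex_of_real (?\<delta> * (r ^ (z + i + 2) / sqrt n) * (?g * r ^ (i + j))) \<cdot>\<^sub>v e j"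
      unfolding smult_smult_assoc of_real_mult[symmetric] by simp
    finally show ?thesis .
  qed
  have "mat_adjoint (test_poly \<eta> n (Suc R) z j Z) *\<^sub>v e k
      = complex_of_real (sqrt n * \<eta>) \<cdot>\<^sub>v (mat_adjoint (code_word z j Z) *\<^sub>v e k)
        + complex_of_real ((1 - \<eta>) / sqrt n) \<cdot>\<^sub>v (mat_adjoint N *\<^sub>v e k)"
    using cw[of j] N unfolding test_poly.simps N_def[symmetric]
    by (simp add: mat_adjoint_add[of _ ?M ?M] mat_adjoint_smult add_mult_distrib_mat_vec[of _ ?M ?M]
        smult_mat_mult_vec[of _ ?M ?M])
  also have "mat_adjoint N *\<^sub>v e k = vec_sum ?M n (\<lambda>i. mat_adjoint (code_word z i Z * test_poly \<eta> n R i j Z) *\<^sub>v e k)"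
    unfolding N_def
    by (rule nc_sum_adjoint_mult_vec[where X = Z and k = n and f = "\<lambda>i X. code_word z i X * test_poly \<eta> n R i j X",
          OF X0 prod unit_vec_carrier])
  also have "\<dots> = complex_of_real (\<Sum>i<n. ?\<delta> * (r ^ (z + i + 2) / sqrt n) * (?g * r ^ (i + j))) \<cdot>\<^sub>v e j"
    by (intro eq_vecI) (simp_all add: prod_adjoint sum_distrib_right)
  also have "complex_of_real (sqrt n * \<eta>) \<cdot>\<^sub>v (mat_adjoint (code_word z j Z) *\<^sub>v e k)
        + complex_of_real ((1 - \<eta>) / sqrt n) \<cdot>\<^sub>v
          (complex_of_real (\<Sum>i<n. ?\<delta> * (r ^ (z + i + 2) / sqrt n) * (?g * r ^ (i + j))) \<cdot>\<^sub>v e j)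
      = complex_of_real (sqrt n * \<eta> * (?\<delta> * (r ^ (z + j + 2) / sqrt n))
        + (1 - \<eta>) / sqrt n * (\<Sum>i<n. ?\<delta> * (r ^ (z + i + 2) / sqrt n) * (?g * r ^ (i + j)))) \<cdot>\<^sub>v e j"
    unfolding code_word_adjoint[OF Suc.prems] by (intro eq_vecI) (auto simp: distrib_right)
  also have "sqrt n * \<eta> * (?\<delta> * (r ^ (z + j + 2) / sqrt n))
        + (1 - \<eta>) / sqrt n * (\<Sum>i<n. ?\<delta> * (r ^ (z + i + 2) / sqrt n) * (?g * r ^ (i + j)))
      = (if k = z then gain \<eta> n r (Suc R) * r ^ (z + j) else 0)"
  proof -
    \<comment> \<open>The intermediate index i contributes r^i as the end of the code word and again
      as the start of the remaining factor, hence r^(2 i).\<close>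
    have sum: "(\<Sum>i<n. (r ^ (z + i + 2) / sqrt n) * (?g * r ^ (i + j)))
        = r ^ (z + j) * r\<^sup>2 * ?g / sqrt n * (\<Sum>i<n. r ^ (2 * i))"
      unfolding sum_distrib_left
      by (intro sum.cong refl) (simp add: power_add power_even_eq, simp add: power2_eq_square mult_ac)
    have alg: "s * \<eta> * (P * r\<^sup>2 / s) + (1 - \<eta>) / s * (P * r\<^sup>2 * ?g / s * \<sigma>)
        = r\<^sup>2 * (\<eta> + (1 - \<eta>) * (\<sigma> / (s * s)) * ?g) * P" if "s \<noteq> 0" for s P \<sigma> :: real
      using that by (simp add: field_simps)
    show ?thesis
      using n alg[of "sqrt n" "r ^ (z + j)" "\<Sum>i<n. r ^ (2 * i)"] sum
      by (cases "k = z") (simp_all add: power_add power2_eq_square mult_ac)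
  qed
  finally show ?case .
qed

text \<open>The basis vector at vertex 0 is the one on which the adjoints of row z = 0 act
  nontrivially; they send it to multiples of n different basis vectors.\<close>

lemma test_poly_row_ge:
  assumes \<eta>: "0 < \<eta>" "\<eta> < 1"
  shows "(gain \<eta> n r R)\<^sup>2 * (\<Sum>j<n. r ^ (2 * j))
    \<le> mat_op_norm (mat_sum (2 * n) n (\<lambda>j. test_poly \<eta> n R 0 j Z * mat_adjoint (test_poly \<eta> n R 0 j Z)))"
proof -
  have M: "1 \<le> 2 * n" using n by simp
  have tp: "test_poly \<eta> n R 0 j Z \<in> carrier_mat (2 * n) (2 * n)" for j
    by (rule nc_function_carrier[OF nc_function_test_poly[OF d] M Z_ball])
  have norm_e: "vec_l2_norm (e k) = 1" if "k < 2 * n" for k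
  proof -
    have "(vec_l2_norm (e k))\<^sup>2 = (\<Sum>i<2*n. if i = k then 1 else 0)"
      unfolding vec_l2_norm_sq by (intro sum.cong) (auto simp: unit_vec_def)
    then have "(vec_l2_norm (e k))\<^sup>2 = 1"
      using that by simp
    then show ?thesis
      using vec_l2_norm_nonneg[of "e k"] by (simp add: power2_eq_1_iff)
  qed
  have "(\<Sum>j<n. (vec_l2_norm (mat_adjoint (test_poly \<eta> n R 0 j Z) *\<^sub>v e 0))\<^sup>2)
      = (\<Sum>j<n. (gain \<eta> n r R)\<^sup>2 * r ^ (2 * j))"
    using test_poly_adjoint[of 0 _ \<eta> R 0] \<eta> n
    by (intro sum.cong refl)
      (simp add: vec_l2_norm_smult norm_e power_mult_distrib power_even_eq del: of_real_mult)
  moreover have "(\<Sum>j<n. (vec_l2_norm (mat_adjoint (test_poly \<eta> n R 0 j Z) *\<^sub>v e 0))\<^sup>2)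
      \<le> mat_op_norm (mat_sum (2 * n) n (\<lambda>j. test_poly \<eta> n R 0 j Z * mat_adjoint (test_poly \<eta> n R 0 j Z)))"
    using gram_norm_lower[of n "\<lambda>j. mat_adjoint (test_poly \<eta> n R 0 j Z)" "2 * n" "e 0"] tp norm_e[of 0] n
    by simp
  ultimately show ?thesis
    by (simp add: sum_distrib_left)
qed

end

section \<open>The lower bound\<close>

lemma gain_nonneg: "0 < \<eta> \<Longrightarrow> \<eta> < 1 \<Longrightarrow> 0 < r \<Longrightarrow> 0 \<le> gain \<eta> n r R"
  by (induction R) (auto intro!: mult_nonneg_nonneg add_nonneg_nonneg divide_nonneg_nonneg sum_nonneg)

lemma gain_pos: "0 < \<eta> \<Longrightarrow> \<eta> < 1 \<Longrightarrow> 0 < r \<Longrightarrow> 0 < gain \<eta> n r (Suc R)"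
  using gain_nonneg[of \<eta> r n R]
  by (auto intro!: mult_pos_pos add_pos_nonneg mult_nonneg_nonneg divide_nonneg_nonneg sum_nonneg)

lemma isCont_gain: "isCont (\<lambda>r. gain \<eta> n r R) x"
  by (induction R) (auto simp: divide_inverse intro!: continuous_intros)

lemma gain_one: "1 \<le> n \<Longrightarrow> gain \<eta> n 1 R = 1 - (1 - \<eta>) ^ R"
proof (induction R)
  case (Suc R)
  then have "gain \<eta> n 1 (Suc R) = \<eta> + (1 - \<eta>) * (1 - (1 - \<eta>) ^ R)"
    by simp
  then show ?case
    by (simp add: algebra_simps)
qed simp

declare test_poly.simps [simp del] gain.simps [simp del]

lemma test_poly_H_infty:
  assumes "2 \<le> d" "1 \<le> n" "0 < \<eta>" "\<eta> < 1" "j < n"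
  shows "test_poly \<eta> n (Suc R) z j \<in> H_infty d"
proof -
  have "mat_op_norm (test_poly \<eta> n (Suc R) z j X) \<le> 1 + (real n)\<^sup>2 * \<eta>" if X: "X \<in> row_ball d" for X
  proof (rule mat_op_norm_leI)
    obtain m where m: "1 \<le> m" "X \<in> row_ball_level d m"
      using X by (auto simp: row_ball_def simp del: One_nat_def)
    fix v :: "complex vec" assume "v \<in> carrier_vec (dim_col (test_poly \<eta> n (Suc R) z j X))"
    then have v: "v \<in> carrier_vec m"
      using nc_function_carrier[OF nc_function_test_poly[OF assms(1)] m, of \<eta> n "Suc R" z j] by auto
    have "(vec_l2_norm (test_poly \<eta> n (Suc R) z j X *\<^sub>v v))\<^sup>2
        \<le> (\<Sum>j<n. (vec_l2_norm (test_poly \<eta> n (Suc R) z j X *\<^sub>v v))\<^sup>2)"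
      using assms(5) by (intro member_le_sum[where f = "\<lambda>j. (vec_l2_norm (test_poly \<eta> n (Suc R) z j X *\<^sub>v v))\<^sup>2"]) simp_all
    also have "\<dots> \<le> ((1 + (real n)\<^sup>2 * \<eta>) * vec_l2_norm v)\<^sup>2"
      unfolding power_mult_distrib
      by (rule test_poly_column_le[OF assms(1) m(1) assms(2) m(2) assms(3,4) v])
    finally show "vec_l2_norm (test_poly \<eta> n (Suc R) z j X *\<^sub>v v) \<le> (1 + (real n)\<^sup>2 * \<eta>) * vec_l2_norm v"
      by (rule power2_le_imp_le) (use assms(3) in simp)
  qed (use assms(3) in simp)
  then have "bdd_above ((\<lambda>X. mat_op_norm (test_poly \<eta> n (Suc R) z j X)) ` row_ball d)"
    by (intro bdd_aboveI2)
  then show ?thesis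
    using nc_function_test_poly[OF assms(1)] by (simp add: H_infty_def)
qed

lemma test_poly_column_norm_le:
  assumes "2 \<le> d" "1 \<le> n" "0 < \<eta>" "\<eta> < 1"
  shows "column_norm d n (test_poly \<eta> n (Suc R) z) \<le> 1 + (real n)\<^sup>2 * \<eta>"
  unfolding column_norm_def
proof (rule cSup_least)
  let ?S = "{sqrt (mat_op_norm (mat_sum m n (\<lambda>i. mat_adjoint (test_poly \<eta> n (Suc R) z i X)
    * test_poly \<eta> n (Suc R) z i X))) | m X. 1 \<le> m \<and> X \<in> row_ball_level d m}"
  show "?S \<noteq> {}"
    using row_ball_level_nonempty[of d] by blast
  fix x assume "x \<in> ?S"
  then obtain m X where m: "1 \<le> m" "X \<in> row_ball_level d m"
    and x: "x = sqrt (mat_op_norm (mat_sum m n (\<lambda>i. mat_adjoint (test_poly \<eta> n (Suc R) z i X)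
      * test_poly \<eta> n (Suc R) z i X)))"
    by blast
  have "mat_op_norm (mat_sum m n (\<lambda>i. mat_adjoint (test_poly \<eta> n (Suc R) z i X) * test_poly \<eta> n (Suc R) z i X))
      \<le> (1 + (real n)\<^sup>2 * \<eta>)\<^sup>2"
  proof (rule gram_norm_upper)
    show "test_poly \<eta> n (Suc R) z i X \<in> carrier_mat m m" for i
      by (rule nc_function_carrier[OF nc_function_test_poly[OF assms(1)] m])
    show "(\<Sum>j<n. (vec_l2_norm (test_poly \<eta> n (Suc R) z j X *\<^sub>v v))\<^sup>2)
        \<le> (1 + (real n)\<^sup>2 * \<eta>)\<^sup>2 * (vec_l2_norm v)\<^sup>2" if "v \<in> carrier_vec m" for v
      by (rule test_poly_column_le[OF assms(1) m(1) assms(2) m(2) assms(3,4) that])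
  qed simp
  then have "x \<le> sqrt ((1 + (real n)\<^sup>2 * \<eta>)\<^sup>2)"
    unfolding x by (rule real_sqrt_le_mono)
  then show "x \<le> 1 + (real n)\<^sup>2 * \<eta>"
    using assms(3) by simp
qed

text \<open>Three limits are taken in this order: r to 1 with \<eta> and R fixed, then R to
  infinity, then \<eta> to 0. The column bound is uniform in R, which permits the second limit
  before the third.\<close>

lemma column_row_bound_ge_sqrt:
  assumes d: "2 \<le> d" and n: "1 \<le> n" and bound: "column_row_bound d n C"
  shows "sqrt (real n) \<le> C"
proof -
  have ge: "gain \<eta> n r (Suc R) * sqrt (\<Sum>j<n. r ^ (2 * j)) \<le> C * column_norm d n (test_poly \<eta> n (Suc R) 0)"
    if r: "0 < r" "r < 1" and \<eta>: "0 < \<eta>" "\<eta> < 1" for r \<eta> R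
  proof -
    have f: "test_poly \<eta> n (Suc R) 0 i \<in> H_infty d" if "i < n" for i
      by (rule test_poly_H_infty[OF d n \<eta> that])
    have "gain \<eta> n r (Suc R) * sqrt (\<Sum>j<n. r ^ (2 * j)) = sqrt ((gain \<eta> n r (Suc R))\<^sup>2 * (\<Sum>j<n. r ^ (2 * j)))"
      using gain_pos[OF \<eta> r(1)] by (simp add: real_sqrt_mult less_imp_le)
    also have "\<dots> \<le> sqrt (mat_op_norm (mat_sum (2 * n) n (\<lambda>j. test_poly \<eta> n (Suc R) 0 j (test_point d n r)
        * mat_adjoint (test_poly \<eta> n (Suc R) 0 j (test_point d n r)))))"
      by (rule real_sqrt_le_mono[OF test_poly_row_ge[OF d n r \<eta>]])
    also have "\<dots> \<le> row_norm d n (test_poly \<eta> n (Suc R) 0)"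
      using n by (intro row_norm_upper f test_point_in_ball[OF d n r]) auto
    also have "\<dots> \<le> C * column_norm d n (test_poly \<eta> n (Suc R) 0)"
      using bound f by (simp add: column_row_bound_def)
    finally show ?thesis .
  qed
  have col_nonneg: "0 \<le> column_norm d n (test_poly \<eta> n (Suc R) 0)" if \<eta>: "0 < \<eta>" "\<eta> < 1" for \<eta> R
  proof -
    have "sqrt (mat_op_norm (mat_sum 1 n (\<lambda>i. mat_adjoint (test_poly \<eta> n (Suc R) 0 i (replicate d (0\<^sub>m 1 1)))
        * test_poly \<eta> n (Suc R) 0 i (replicate d (0\<^sub>m 1 1))))) \<le> column_norm d n (test_poly \<eta> n (Suc R) 0)"
      by (rule column_norm_upper[OF test_poly_H_infty[OF d n \<eta>] order_refl row_ball_level_nonempty])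
    then show ?thesis
      by (rule order_trans[OF real_sqrt_ge_zero[OF mat_op_norm_nonneg]])
  qed
  \<comment> \<open>The sign is settled first because C is about to multiply an upper bound for the
    column norm. A negative C would contradict the positive row value already at \<eta> = r = 1/2
    with a single term.\<close>
  have C: "0 \<le> C"
  proof (rule ccontr)
    assume "\<not> 0 \<le> C"
    then have "C * column_norm d n (test_poly (1 / 2) n (Suc 0) 0) \<le> 0"
      using col_nonneg[of "1 / 2" 0] by (intro mult_nonpos_nonneg) auto
    moreover have "0 < (\<Sum>j<n. (1 / 2 :: real) ^ (2 * j))"
      using n by (intro sum_pos) (auto simp: lessThan_empty_iff)
    then have "0 < gain (1 / 2) n (1 / 2) (Suc 0) * sqrt (\<Sum>j<n. (1 / 2 :: real) ^ (2 * j))"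
      by (intro mult_pos_pos gain_pos) auto
    ultimately show False
      using ge[of "1 / 2" "1 / 2" 0] by linarith
  qed
  have bound_\<eta>: "sqrt (real n) \<le> C * (1 + (real n)\<^sup>2 * \<eta>)" if \<eta>: "0 < \<eta>" "\<eta> < 1" for \<eta>
  proof -
    have le: "gain \<eta> n r (Suc R) * sqrt (\<Sum>j<n. r ^ (2 * j)) \<le> C * (1 + (real n)\<^sup>2 * \<eta>)"
      if r: "0 < r" "r < 1" for r R
      using ge[OF r \<eta>] mult_left_mono[OF test_poly_column_norm_le[OF d n \<eta>] C] by (rule order_trans)
    have "(1 - (1 - \<eta>) ^ Suc R) * sqrt (real n) \<le> C * (1 + (real n)\<^sup>2 * \<eta>)" for R
    proof -
      \<comment> \<open>For fixed R the gain is a polynomial in r, so the boundary value at r = 1 is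
        reached as a limit from inside the ball.\<close>
      have "isCont (\<lambda>r. gain \<eta> n r (Suc R) * sqrt (\<Sum>j<n. r ^ (2 * j))) 1"
        by (intro continuous_intros isCont_gain)
      then have "((\<lambda>r. gain \<eta> n r (Suc R) * sqrt (\<Sum>j<n. r ^ (2 * j)))
          \<longlongrightarrow> gain \<eta> n 1 (Suc R) * sqrt (\<Sum>j<n. 1 ^ (2 * j))) (at_left 1)"
        unfolding isCont_def by (rule tendsto_mono[OF at_le[OF subset_UNIV]])
      then have "gain \<eta> n 1 (Suc R) * sqrt (\<Sum>j<n. 1 ^ (2 * j)) \<le> C * (1 + (real n)\<^sup>2 * \<eta>)"
      proof (rule tendsto_upperbound)
        show "\<forall>\<^sub>F r in at_left 1. gain \<eta> n r (Suc R) * sqrt (\<Sum>j<n. r ^ (2 * j)) \<le> C * (1 + (real n)\<^sup>2 * \<eta>)"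
          using eventually_at_left_real[of 0 1] by (rule eventually_mono) (auto intro: le)
      qed simp
      then show ?thesis
        by (simp add: gain_one[OF n])
    qed
    moreover have "(\<lambda>R. (1 - (1 - \<eta>) ^ Suc R) * sqrt (real n)) \<longlonglongrightarrow> (1 - 0) * sqrt (real n)"
      using \<eta> by (intro tendsto_intros LIMSEQ_Suc LIMSEQ_power_zero) auto
    ultimately show ?thesis
      using LIMSEQ_le_const2[of _ "(1 - 0) * sqrt (real n)"] by simp
  qed
  have "((\<lambda>\<eta>. C * (1 + (real n)\<^sup>2 * \<eta>)) \<longlongrightarrow> C * (1 + (real n)\<^sup>2 * 0)) (at_right 0)"
    by (intro tendsto_intros)
  then have "sqrt (real n) \<le> C * (1 + (real n)\<^sup>2 * 0)"
  proof (rule tendsto_lowerbound)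
    show "\<forall>\<^sub>F \<eta> in at_right 0. sqrt (real n) \<le> C * (1 + (real n)\<^sup>2 * \<eta>)"
      using eventually_at_right_real[of 0 1] by (rule eventually_mono) (auto intro: bound_\<eta>)
  qed simp
  then show ?thesis by simp
qed

theorem theorem1p1:
  fixes d n :: nat
  assumes "d \<ge> 2" and "n \<ge> 1"
  shows "is_column_row_constant d n (sqrt (real n))"
  unfolding is_column_row_constant_def
  using column_row_bound_sqrt column_row_bound_ge_sqrt[OF assms] by blast

end
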